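(* Let $G=(V,\lambda)$ be a weighted graph (with $V$ finite or countably infinite) such that $$\Psi^{-1}:=\sum_{k\ge 0}\frac{1}{\psi_\lambda(2^k)}<\frac{1}{625},$$ where the sum runs over those integers $k\ge 0$ for which $2^k$ lies in the domain $\{1,\dots,\lfloor |V|/2\rfloor\}$ of $\psi_\lambda$ (all $k\ge0$ if $V$ is infinite). Set $\varepsilon:=25/\sqrt{\Psi}<1$. Then the following holds. (i) If $V$ is finite, then for every $x,y\in V$, $$\mathbb P_\lambda(x\leftrightarrow y)\ge 1-e^{-(1-\varepsilon)\chi_\lambda(x,y)}.$$ (ii) If $V$ is infinite, then for every $x\in V$, $$\mathbb P_\lambda(x\leftrightarrow\infty)\ge 1-e^{-(1-\varepsilon)\chi_\lambda(x)}.$$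
   Context: A weighted graph $G=(V,\lambda)$ consists of a finite or countably infinite set $V$ and a family $\lambda=(\lambda_{\{x,y\}})_{\{x,y\}\subset V}$ of non-negative real weights indexed by unordered pairs of distinct vertices. Its edge set is $E:=\{\{x,y\}:\lambda_{\{x,y\}}>0\}$. For $F\subset E$, $\|F\|_\lambda:=\sum_{f\in F}\lambda_f\in[0,\infty]$. For $S\subset V$, the edge boundary is $\partial S:=\{\{x,y\}\in E: x\in S,\ y\notin S\}$. The weighted isoperimetric profile $\psi_\lambda:\{1,\dots,\lfloor |V|/2\rfloor\}\to[0,\infty]$ (domain all positive integers if $V$ is infinite) is $$\psi_\lambda(n):=\inf\{\|\partial S\|_\lambda: S\subset V,\ n\le |S|\le \min(2n,|V|/2)\}.$$ For $x,y\in V$, $$\chi_\lambda(x,y)=\inf\{\|\partial S\|_\lambda: x\in S\subset V\setminus\{y\}\},\qquad \chi_\lambda(x)=\inf\{\|\partial S\|_\lambda: x\in S\subset V,\ S\text{ finite}\}.$$ Conventions: $1/\infty=0$, $1/0=\infty$, $\inf\varnothing=\infty$, $e^{-\infty}=0$; if $\Psi=\infty$ then $\varepsilon=0$. Bond percolation: under $\mathbb P_\lambda$ each edge $e\in E$ is open independently with probability $p_e:=1-e^{-\lambda_e}$; $\omega\subset E$ denotes the set of open edges. The event $x\leftrightarrow y$ is that $x$ and $y$ lie in the same connected component of $(V,\omega)$; $x\leftrightarrow\infty$ is the event that $x\leftrightarrow y$ for infinitely many $y\in V$. *)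

theory Defs
  imports "HOL-Probability.Probability"
begin

text \<open>
  Weights are given by a function on sets; only its values on two-element subsets of the
  vertex set are ever used.
\<close>

definition weighted_graph :: "'a set \<Rightarrow> ('a set \<Rightarrow> real) \<Rightarrow> bool" where
  "weighted_graph V l \<longleftrightarrow> countable V \<and> (\<forall>x\<in>V. \<forall>y\<in>V. x \<noteq> y \<longrightarrow> 0 \<le> l {x, y})"

definition edges :: "'a set \<Rightarrow> ('a set \<Rightarrow> real) \<Rightarrow> 'a set set" where
  "edges V l = {{x, y} | x y. x \<in> V \<and> y \<in> V \<and> x \<noteq> y \<and> 0 < l {x, y}}"

definition total_weight :: "('a set \<Rightarrow> real) \<Rightarrow> 'a set set \<Rightarrow> ennreal" where
  "total_weight l F = (\<Sum>\<^sub>\<infinity>f\<in>F. ennreal (l f))"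

definition edge_boundary :: "'a set \<Rightarrow> ('a set \<Rightarrow> real) \<Rightarrow> 'a set \<Rightarrow> 'a set set" where
  "edge_boundary V l S = {{x, y} | x y. {x, y} \<in> edges V l \<and> x \<in> S \<and> y \<notin> S}"

definition profile_domain :: "'a set \<Rightarrow> nat set" where
  "profile_domain V = {n. 1 \<le> n \<and> (finite V \<longrightarrow> n \<le> card V div 2)}"

text \<open>
  For infinite \<open>V\<close> the upper bound \<open>|V|/2\<close> is infinite and imposes no condition (whereas
  \<open>card V = 0\<close>); the bound \<open>|S| \<le> 2n\<close> forces \<open>S\<close> to be finite.
  Throughout, the infimum of the empty set in \<^typ>\<open>ennreal\<close> is \<open>\<infinity>\<close>.
\<close>

definition iso_profile :: "'a set \<Rightarrow> ('a set \<Rightarrow> real) \<Rightarrow> nat \<Rightarrow> ennreal" where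
  "iso_profile V l n =
     Inf {total_weight l (edge_boundary V l S) | S.
            S \<subseteq> V \<and> finite S \<and> n \<le> card S \<and> card S \<le> 2 * n \<and>
            (finite V \<longrightarrow> real (card S) \<le> real (card V) / 2)}"

definition chi_pair :: "'a set \<Rightarrow> ('a set \<Rightarrow> real) \<Rightarrow> 'a \<Rightarrow> 'a \<Rightarrow> ennreal" where
  "chi_pair V l x y =
     Inf {total_weight l (edge_boundary V l S) | S. x \<in> S \<and> S \<subseteq> V - {y}}"

definition chi_infinity :: "'a set \<Rightarrow> ('a set \<Rightarrow> real) \<Rightarrow> 'a \<Rightarrow> ennreal" where
  "chi_infinity V l x =
     Inf {total_weight l (edge_boundary V l S) | S. x \<in> S \<and> S \<subseteq> V \<and> finite S}"

text \<open>Division in \<^typ>\<open>ennreal\<close> satisfies \<open>1 / 0 = \<infinity>\<close> and \<open>1 / \<infinity> = 0\<close>.\<close>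

definition Psi_inv :: "'a set \<Rightarrow> ('a set \<Rightarrow> real) \<Rightarrow> ennreal" where
  "Psi_inv V l = (\<Sum>\<^sub>\<infinity>k\<in>{k::nat. 2 ^ k \<in> profile_domain V}. 1 / iso_profile V l (2 ^ k))"

definition Psi :: "'a set \<Rightarrow> ('a set \<Rightarrow> real) \<Rightarrow> ennreal" where
  "Psi V l = 1 / Psi_inv V l"

definition eps :: "'a set \<Rightarrow> ('a set \<Rightarrow> real) \<Rightarrow> real" where
  "eps V l = (if Psi V l = \<infinity> then 0 else 25 / sqrt (enn2real (Psi V l)))"

definition exp_neg :: "ennreal \<Rightarrow> real" where
  "exp_neg t = (if t = \<infinity> then 0 else exp (- enn2real t))"

definition percolation :: "'a set \<Rightarrow> ('a set \<Rightarrow> real) \<Rightarrow> ('a set \<Rightarrow> bool) measure" where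
  "percolation V l = PiM (edges V l) (\<lambda>e. measure_pmf (bernoulli_pmf (1 - exp (- l e))))"

definition open_edges :: "'a set \<Rightarrow> ('a set \<Rightarrow> real) \<Rightarrow> ('a set \<Rightarrow> bool) \<Rightarrow> 'a set set" where
  "open_edges V l \<omega> = {e \<in> edges V l. \<omega> e}"

definition linked :: "'a set set \<Rightarrow> 'a \<Rightarrow> 'a \<Rightarrow> bool" where
  "linked F x y \<longleftrightarrow> (x, y) \<in> {(u, v). {u, v} \<in> F}\<^sup>*"

definition connection_event ::
  "'a set \<Rightarrow> ('a set \<Rightarrow> real) \<Rightarrow> 'a \<Rightarrow> 'a \<Rightarrow> ('a set \<Rightarrow> bool) set" where
  "connection_event V l x y =
     {\<omega> \<in> space (percolation V l). linked (open_edges V l \<omega>) x y}"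

definition infinity_event ::
  "'a set \<Rightarrow> ('a set \<Rightarrow> real) \<Rightarrow> 'a \<Rightarrow> ('a set \<Rightarrow> bool) set" where
  "infinity_event V l x =
     {\<omega> \<in> space (percolation V l). infinite {y \<in> V. linked (open_edges V l \<omega>) x y}}"

end

theory Submission
  imports Defs "HOL-Library.Discrete_Functions"
begin

text \<open>
  Suppose that \<open>x\<close> is cut off, and let \<open>S\<close> be the closed cut around \<open>x\<close> of least weight \<open>A\<close>.
  A given cut is closed with probability \<open>e\<^sup>-\<^sup>A\<close>, so one has to control the number of candidates,
  which is done with a Karger-type contraction scheme. Starting from singletons,
  the smallest block \<open>C\<close> not containing \<open>x\<close> or a sink is repeatedly merged along a random edge of \<open>\<partial>C\<close>,
  chosen proportionally to \<open>\<lambda>\<close>. Every vertex lies at most once in a merging block of size between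
  \<open>2\<^sup>k\<close> and \<open>2\<^sup>k\<^sup>+\<^sup>1\<close>, and such a block satisfies \<open>\<parallel>\<partial>C\<parallel> \<ge> \<psi>(2\<^sup>k)\<close>; hence the merges respect \<open>S\<close> with
  probability at least \<open>exp (-4 A/\<Psi>)\<close>, provided that \<open>S\<close> is replaced by \<open>S \<triangle> C\<close> whenever more than
  three quarters of \<open>\<partial>C\<close> belong to \<open>\<partial>S\<close>. Such a flip lowers the weight of the cut by at least
  \<open>\<parallel>\<partial>C\<parallel>/2\<close>. At the end only two cuts \<open>T\<close> remain, and \<open>S\<close> is recovered from \<open>T\<close> and the family \<open>F\<close> of
  flipped blocks. By minimality of \<open>S\<close>, the blocks of \<open>F\<close> that are not connected to \<open>\<partial>T\<close> through open
  edges may be dropped; the families that are so connected are summed by exploring edges one at a time,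
  each flipped block contributing the small factor \<open>exp (-\<parallel>\<partial>C\<parallel>/2)\<close>. This gives
  the bound \<open>2 exp (-(1 - 11/\<Psi>) \<chi>)\<close>, and \<open>\<chi> \<ge> \<Psi>\<close> absorbs the factor 2.
\<close>

section \<open>Percolation on a finite edge set\<close>

text \<open>The expectation of \<open>f\<close> at the random set \<open>Q\<close> of open edges. As
  a finite sum it can be treated by revealing edges one at a time;
  \<open>finite_pattern_prob\<close> ties it to the product measure.\<close>

definition perc_sum :: "('e \<Rightarrow> real) \<Rightarrow> 'e set \<Rightarrow> ('e set \<Rightarrow> real) \<Rightarrow> real" where
  "perc_sum l E f =
     (\<Sum>Q\<in>Pow E. (\<Prod>e\<in>Q. 1 - exp (- l e)) * (\<Prod>e\<in>E - Q. exp (- l e)) * f Q)"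

lemma perc_sum_empty [simp]: "perc_sum l {} f = f {}"
  by (simp add: perc_sum_def)

text \<open>Conditioning on the state of \<open>e\<close>: closed in the first term, open in the
  second.\<close>

lemma perc_sum_insert:
  assumes "finite E" "e \<notin> E"
  shows "perc_sum l (insert e E) f =
    exp (- l e) * perc_sum l E f + (1 - exp (- l e)) * perc_sum l E (\<lambda>Q. f (insert e Q))"
proof -
  let ?w = "\<lambda>E Q. (\<Prod>e\<in>Q. 1 - exp (- l e)) * (\<Prod>e\<in>E - Q. exp (- l e))"
  have disj: "Pow E \<inter> insert e ` Pow E = {}" using assms by auto
  have inj: "inj_on (insert e) (Pow E)"
    using assms by (intro inj_onI) (metis PowD insert_ident subset_iff)
  have "perc_sum l (insert e E) f =
      (\<Sum>Q\<in>Pow E. ?w (insert e E) Q * f Q) + (\<Sum>Q\<in>insert e ` Pow E. ?w (insert e E) Q * f Q)"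
    unfolding perc_sum_def Pow_insert using assms disj by (subst sum.union_disjoint) auto
  also have "(\<Sum>Q\<in>insert e ` Pow E. ?w (insert e E) Q * f Q)
      = (\<Sum>Q\<in>Pow E. ?w (insert e E) (insert e Q) * f (insert e Q))"
    using inj by (simp add: sum.reindex)
  also have "\<dots> = (\<Sum>Q\<in>Pow E. (1 - exp (- l e)) * (?w E Q * f (insert e Q)))"
  proof (rule sum.cong[OF refl])
    fix Q assume Q: "Q \<in> Pow E"
    have "insert e E - insert e Q = E - Q" using Q assms by auto
    moreover have "finite Q" "e \<notin> Q" using Q assms by (auto intro: finite_subset)
    ultimately show "?w (insert e E) (insert e Q) * f (insert e Q) = (1 - exp (- l e)) * (?w E Q * f (insert e Q))"
      by simp
  qed
  also have "(\<Sum>Q\<in>Pow E. ?w (insert e E) Q * f Q) = (\<Sum>Q\<in>Pow E. exp (- l e) * (?w E Q * f Q))"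
  proof (rule sum.cong[OF refl])
    fix Q assume Q: "Q \<in> Pow E"
    have "insert e E - Q = insert e (E - Q)" "e \<notin> E - Q" "finite (E - Q)" using Q assms by auto
    then show "?w (insert e E) Q * f Q = exp (- l e) * (?w E Q * f Q)" by simp
  qed
  finally show ?thesis by (simp add: perc_sum_def sum_distrib_left)
qed

lemma perc_sum_mono:
  assumes "\<And>e. e \<in> E \<Longrightarrow> 0 \<le> l e" and "\<And>Q. Q \<subseteq> E \<Longrightarrow> f Q \<le> g Q"
  shows "perc_sum l E f \<le> perc_sum l E g"
  unfolding perc_sum_def
  using assms by (intro sum_mono mult_left_mono mult_nonneg_nonneg prod_nonneg) auto

lemma perc_sum_cmult: "perc_sum l E (\<lambda>Q. c * f Q) = c * perc_sum l E f"
  by (simp add: perc_sum_def sum_distrib_left mult_ac)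

lemma perc_sum_sum: "perc_sum l E (\<lambda>Q. \<Sum>i\<in>I. f i Q) = (\<Sum>i\<in>I. perc_sum l E (f i))"
  unfolding perc_sum_def sum_distrib_left by (rule sum.swap)

lemma perc_sum_const: "finite E \<Longrightarrow> perc_sum l E (\<lambda>Q. c) = c"
  by (induction E rule: finite_induct) (simp_all add: perc_sum_insert algebra_simps)

lemma perc_sum_nonneg:
  assumes "finite E" "\<And>e. e \<in> E \<Longrightarrow> 0 \<le> l e" and "\<And>Q. Q \<subseteq> E \<Longrightarrow> 0 \<le> f Q"
  shows "0 \<le> perc_sum l E f"
  using perc_sum_mono[of E l "\<lambda>_. 0" f] perc_sum_const[OF assms(1), of l 0] assms(2,3) by simp

text \<open>A Harris-type inequality: closedness of \<open>D\<close> is decreasing and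
  \<open>f\<close> is increasing, so the two are negatively correlated. In the induction an edge of
  \<open>D\<close> contributes only when closed, and by monotonicity \<open>f\<close> is on average
  no smaller when that edge is open.\<close>

lemma perc_sum_closed_le:
  assumes "finite E" "\<And>e. e \<in> E \<Longrightarrow> 0 \<le> l e" "D \<subseteq> E" "\<And>Q. 0 \<le> f Q" "mono f"
  shows "perc_sum l E (\<lambda>Q. of_bool (Q \<inter> D = {}) * f Q) \<le> exp (- sum l D) * perc_sum l E f"
  using assms
proof (induction E arbitrary: D f rule: finite_induct)
  case empty
  then show ?case by simp
next
  case (insert e E)
  have pos: "\<And>e. e \<in> E \<Longrightarrow> 0 \<le> l e" and le: "0 \<le> l e" using insert.prems by auto
  have mono': "mono (\<lambda>Q. f (insert e Q))"
    by (intro monoI monoD[OF insert.prems(4)]) auto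
  have up: "perc_sum l E f \<le> perc_sum l E (\<lambda>Q. f (insert e Q))"
    using pos by (intro perc_sum_mono monoD[OF insert.prems(4)]) auto
  have nn: "0 \<le> perc_sum l E f" using pos insert.hyps insert.prems by (intro perc_sum_nonneg) auto
  show ?case
  proof (cases "e \<in> D")
    case True
    define D' where "D' = D - {e}"
    have D': "D = insert e D'" "e \<notin> D'" "D' \<subseteq> E" "finite D'"
      using True insert.prems insert.hyps by (auto simp: D'_def intro: finite_subset)
    have "perc_sum l E (\<lambda>Q. of_bool (Q \<inter> D = {}) * f Q) = perc_sum l E (\<lambda>Q. of_bool (Q \<inter> D' = {}) * f Q)"
      unfolding perc_sum_def using D' insert.hyps by (intro sum.cong) auto
    also have "\<dots> \<le> exp (- sum l D') * perc_sum l E f"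
      by (rule insert.IH[OF pos D'(3) insert.prems(3,4)])
    finally have 1: "perc_sum l E (\<lambda>Q. of_bool (Q \<inter> D = {}) * f Q) \<le> exp (- sum l D') * perc_sum l E f" .
    have 2: "perc_sum l E (\<lambda>Q. of_bool (insert e Q \<inter> D = {}) * f (insert e Q)) = 0"
      using True insert.hyps by (simp add: perc_sum_const)
    have 3: "exp (- sum l D) = exp (- l e) * exp (- sum l D')"
      using D' by (simp add: exp_add[symmetric])
    have "perc_sum l (insert e E) (\<lambda>Q. of_bool (Q \<inter> D = {}) * f Q)
       \<le> exp (- l e) * (exp (- sum l D') * perc_sum l E f)"
      using insert.hyps 1 2 by (simp add: perc_sum_insert)
    also have "\<dots> = exp (- sum l D) * (exp (- l e) * perc_sum l E f + (1 - exp (- l e)) * perc_sum l E f)"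
      by (simp add: 3 algebra_simps)
    also have "\<dots> \<le> exp (- sum l D) * perc_sum l (insert e E) f"
      unfolding perc_sum_insert[OF insert.hyps] using up le by (intro mult_left_mono add_left_mono) auto
    finally show ?thesis .
  next
    case False
    then have D: "D \<subseteq> E" and ins: "\<And>Q. insert e Q \<inter> D = Q \<inter> D" using insert.prems by auto
    have 1: "exp (- l e) * perc_sum l E (\<lambda>Q. of_bool (Q \<inter> D = {}) * f Q)
        \<le> exp (- l e) * (exp (- sum l D) * perc_sum l E f)"
      using insert.IH[OF pos D insert.prems(3,4)] by (intro mult_left_mono) auto
    have 2: "(1 - exp (- l e)) * perc_sum l E (\<lambda>Q. of_bool (Q \<inter> D = {}) * f (insert e Q))
        \<le> (1 - exp (- l e)) * (exp (- sum l D) * perc_sum l E (\<lambda>Q. f (insert e Q)))"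
      using insert.IH[OF pos D _ mono'] insert.prems(3) le by (intro mult_left_mono) auto
    have "perc_sum l (insert e E) (\<lambda>Q. of_bool (Q \<inter> D = {}) * f Q)
        \<le> exp (- l e) * (exp (- sum l D) * perc_sum l E f)
          + (1 - exp (- l e)) * (exp (- sum l D) * perc_sum l E (\<lambda>Q. f (insert e Q)))"
      unfolding perc_sum_insert[OF insert.hyps] ins by (rule add_mono[OF 1 2])
    also have "\<dots> = exp (- sum l D) * perc_sum l (insert e E) f"
      unfolding perc_sum_insert[OF insert.hyps] by (simp only: distrib_left mult_ac)
    finally show ?thesis .
  qed
qed

section \<open>Exploration of families joined by open edges\<close>

text \<open>
  Every nonempty \<open>G \<subseteq> F\<close> shares an open edge with the root \<open>P\<close> or with \<open>F - G\<close>, that is, each member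
  of \<open>F\<close> is joined to \<open>P\<close> by a chain of members in which neighbours share an open edge.
\<close>

definition attached :: "('b \<Rightarrow> 'e set) \<Rightarrow> 'e set \<Rightarrow> 'e set \<Rightarrow> 'b set \<Rightarrow> bool" where
  "attached D Q P F \<longleftrightarrow> (\<forall>G\<subseteq>F. G \<noteq> {} \<longrightarrow>
     (\<exists>C\<in>G. \<exists>e\<in>D C \<inter> Q. e \<in> P \<or> (\<exists>C'\<in>F - G. e \<in> D C')))"

lemma attachedE:
  assumes "attached D Q P F" "G \<subseteq> F" "G \<noteq> {}"
  obtains C e where "C \<in> G" "e \<in> D C \<inter> Q" "e \<in> P \<or> (\<exists>C'\<in>F - G. e \<in> D C')"
proof -
  have "\<exists>C\<in>G. \<exists>e\<in>D C \<inter> Q. e \<in> P \<or> (\<exists>C'\<in>F - G. e \<in> D C')"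
    using assms unfolding attached_def by simp
  then show thesis by (elim bexE) (rule that)
qed

lemma attached_mono:
  assumes "Q \<subseteq> Q'" "attached D Q P F"
  shows "attached D Q' P F"
  unfolding attached_def
proof (intro allI impI)
  fix G assume "G \<subseteq> F" "G \<noteq> {}"
  then obtain C e where "C \<in> G" "e \<in> D C \<inter> Q" "e \<in> P \<or> (\<exists>C'\<in>F - G. e \<in> D C')"
    by (rule attachedE[OF assms(2)])
  then show "\<exists>C\<in>G. \<exists>e\<in>D C \<inter> Q'. e \<in> P \<or> (\<exists>C'\<in>F - G. e \<in> D C')"
    using assms(1) by (intro bexI[of _ C] bexI[of _ e]) auto
qed

text \<open>The exploration step when \<open>e\<close> is found open: the members whose edge sets
  contain \<open>e\<close> are absorbed by the root, so a link to one of them becomes a link to the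
  enlarged root. The remaining members cannot use \<open>e\<close> for a link.\<close>

lemma attached_insert:
  assumes "attached D (insert e Q) P F"
  shows "attached D Q (P \<union> (\<Union>C\<in>{C\<in>F. e \<in> D C}. D C)) (F - {C\<in>F. e \<in> D C})"
  unfolding attached_def
proof (intro allI impI)
  fix G assume G: "G \<subseteq> F - {C \<in> F. e \<in> D C}" "G \<noteq> {}"
  then have "G \<subseteq> F" by auto
  then obtain C e' where "C \<in> G" "e' \<in> D C \<inter> insert e Q" "e' \<in> P \<or> (\<exists>C'\<in>F - G. e' \<in> D C')"
    using G(2) by (rule attachedE[OF assms])
  moreover have "e' \<noteq> e" using calculation G by auto
  ultimately show "\<exists>C\<in>G. \<exists>ea\<in>D C \<inter> Q. ea \<in> P \<union> (\<Union>C\<in>{C \<in> F. e \<in> D C}. D C) \<or>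
     (\<exists>C'\<in>F - {C \<in> F. e \<in> D C} - G. ea \<in> D C')"
    by (intro bexI[of _ C] bexI[of _ e']) auto
qed

text \<open>For \<open>G = F\<close> the only possible link is to the root, which has no open
  edge.\<close>

lemma attached_disjoint:
  assumes "attached D Q P F" "Q \<inter> P = {}"
  shows "F = {}"
proof (rule ccontr)
  assume "F \<noteq> {}"
  then obtain C e where "e \<in> D C \<inter> Q" "e \<in> P \<or> (\<exists>C'\<in>F - F. e \<in> D C')"
    by (rule attachedE[OF assms(1) order_refl])
  then show False using assms(2) by auto
qed

lemma sum_Pow_prod:
  fixes a :: "'b \<Rightarrow> real"
  assumes "finite A"
  shows "(\<Sum>F\<in>Pow A. \<Prod>C\<in>F. a C) = (\<Prod>C\<in>A. 1 + a C)"
  using prod_add[OF assms, of a "\<lambda>_. 1"] by (simp add: add.commute)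

lemma sum_UN_le:
  fixes f :: "'b \<Rightarrow> real"
  assumes "finite J" "\<And>C. C \<in> J \<Longrightarrow> finite (A C)" "\<And>C e. C \<in> J \<Longrightarrow> e \<in> A C \<Longrightarrow> 0 \<le> f e"
  shows "sum f (\<Union>C\<in>J. A C) \<le> (\<Sum>C\<in>J. sum f (A C))"
  using assms
proof (induction J rule: finite_induct)
  case (insert C J)
  have "sum f (A C \<union> (\<Union>C\<in>J. A C)) \<le> sum f (A C) + sum f (\<Union>C\<in>J. A C)"
    using insert.hyps insert.prems by (subst sum_Un) (auto intro!: sum_nonneg)
  moreover have "sum f (\<Union>C\<in>J. A C) \<le> (\<Sum>C\<in>J. sum f (A C))"
    using insert.prems by (intro insert.IH) auto
  ultimately show ?case using insert.hyps by simp
qed simp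

lemma sum_Pow_split:
  assumes "finite A" "B \<subseteq> A"
  shows "(\<Sum>F\<in>Pow A. f F) = (\<Sum>J\<in>Pow B. \<Sum>F\<in>Pow (A - B). f (J \<union> F) :: real)"
proof -
  have "(\<Sum>J\<in>Pow B. \<Sum>F\<in>Pow (A - B). f (J \<union> F)) = (\<Sum>(J, F)\<in>Pow B \<times> Pow (A - B). f (J \<union> F))"
    by (simp add: sum.cartesian_product)
  also have "\<dots> = (\<Sum>F\<in>Pow A. f F)"
  proof (rule sum.reindex_bij_witness[of _ "\<lambda>F. (F \<inter> B, F - B)" "\<lambda>(J, F). J \<union> F"])
    fix a assume "a \<in> Pow B \<times> Pow (A - B)"
    then obtain J F where a: "a = (J, F)" "J \<subseteq> B" "F \<subseteq> A - B" by auto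
    then have "(J \<union> F) \<inter> B = J" "(J \<union> F) - B = F" "J \<union> F \<subseteq> A" using assms(2) by auto
    then show "((case a of (J, F) \<Rightarrow> J \<union> F) \<inter> B, (case a of (J, F) \<Rightarrow> J \<union> F) - B) = a"
      "(case a of (J, F) \<Rightarrow> J \<union> F) \<in> Pow A"
      "f (case a of (J, F) \<Rightarrow> J \<union> F) = (case a of (J, F) \<Rightarrow> f (J \<union> F))"
      using a(1) by simp_all
  next
    fix F assume "F \<in> Pow A"
    then show "(case (F \<inter> B, F - B) of (J, F) \<Rightarrow> J \<union> F) = F" "(F \<inter> B, F - B) \<in> Pow B \<times> Pow (A - B)"
      by auto
  qed
  finally show ?thesis by simp
qed

definition attached_weight :: "('b \<Rightarrow> 'e set) \<Rightarrow> ('b \<Rightarrow> real) \<Rightarrow> 'b set \<Rightarrow> 'e set \<Rightarrow> 'e set \<Rightarrow> real" where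
  "attached_weight D g L P Q = (\<Sum>F\<in>Pow L. of_bool (attached D Q P F) * (\<Prod>C\<in>F. g C))"

text \<open>The unexplored part of the root is examined edge by edge. A closed edge is discarded; an
  open edge \<open>e\<close> selects a set \<open>J\<close> of members through \<open>e\<close>,
  whose edges enlarge the root at the price \<open>exp (\<kappa> * d C)\<close> each. The last
  hypothesis bounds the total over \<open>J\<close> by \<open>1 + \<kappa>\<close>, and averaging
  over the state of \<open>e\<close> costs at most \<open>exp (\<kappa> * l e)\<close>. Once the
  root has no edge left, only the empty family is attached.\<close>

lemma expected_attached_weight_le:
  fixes D :: "'b \<Rightarrow> 'e set"
  assumes "finite E" "finite L" "\<And>e. e \<in> E \<Longrightarrow> 0 \<le> l e" "\<And>C. 0 \<le> g C" "0 \<le> \<kappa>"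
    and "\<And>C. C \<in> L \<Longrightarrow> sum l (D C \<inter> E) \<le> d C"
    and "\<And>e. e \<in> E \<Longrightarrow> (\<Prod>C\<in>{C\<in>L. e \<in> D C}. 1 + g C * exp (\<kappa> * d C)) \<le> 1 + \<kappa>"
  shows "perc_sum l E (attached_weight D g L P) \<le> exp (\<kappa> * sum l (P \<inter> E))"
  using assms
proof (induction "card E" arbitrary: E L P rule: less_induct)
  case less
  note fE = less.prems(1) and fL = less.prems(2) and g = less.prems(4)
  show ?case
  proof (cases "P \<inter> E = {}")
    case True
    have "attached_weight D g L P Q = 1" if Q: "Q \<subseteq> E" for Q
    proof -
      have "Q \<inter> P = {}" using True Q by auto
      then have "attached_weight D g L P Q = (\<Sum>F\<in>{{}}. of_bool (attached D Q P F) * (\<Prod>C\<in>F. g C))"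
        unfolding attached_weight_def using fL
        by (intro sum.mono_neutral_right) (auto dest: attached_disjoint)
      then show ?thesis by (simp add: attached_def)
    qed
    then have "perc_sum l E (attached_weight D g L P) = perc_sum l E (\<lambda>_. 1)"
      unfolding perc_sum_def by (intro sum.cong) auto
    then show ?thesis using True fE by (simp add: perc_sum_const)
  next
    case False
    then obtain e where e: "e \<in> P" "e \<in> E" by auto
    define E1 where "E1 = E - {e}"
    have E1: "E = insert e E1" "e \<notin> E1" "finite E1" "card E1 < card E" "E1 \<subseteq> E"
      using e fE by (auto simp: E1_def card_Diff1_less simp del: card_Diff_insert)
    define Le where "Le = {C\<in>L. e \<in> D C}"
    have le: "0 \<le> l e" using e less.prems(3) by auto
    have lpos: "\<And>e. e \<in> E1 \<Longrightarrow> 0 \<le> l e" using less.prems(3) E1 by auto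
    have sub: "sum l (D C \<inter> E1) \<le> d C" if "C \<in> L" for C
    proof -
      have "sum l (D C \<inter> E1) \<le> sum l (D C \<inter> E)"
        using fE E1(5) less.prems(3) by (intro sum_mono2) auto
      then show ?thesis using less.prems(6)[OF that] by linarith
    qed
    have IH: "perc_sum l E1 (attached_weight D g L' P') \<le> exp (\<kappa> * sum l (P' \<inter> E1))" if "L' \<subseteq> L" for L' P'
    proof (rule less.hyps[OF E1(4,3)])
      show "finite L'" using that fL by (rule finite_subset)
      show "\<And>C. C \<in> L' \<Longrightarrow> sum l (D C \<inter> E1) \<le> d C" using that sub by auto
      show "(\<Prod>C\<in>{C \<in> L'. e \<in> D C}. 1 + g C * exp (\<kappa> * d C)) \<le> 1 + \<kappa>" if "e \<in> E1" for e
      proof -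
        have "(\<Prod>C\<in>{C \<in> L'. e \<in> D C}. 1 + g C * exp (\<kappa> * d C)) \<le> (\<Prod>C\<in>{C \<in> L. e \<in> D C}. 1 + g C * exp (\<kappa> * d C))"
          using \<open>L' \<subseteq> L\<close> fL g by (intro prod_mono2) (auto intro: add_nonneg_nonneg)
        also have "\<dots> \<le> 1 + \<kappa>" using less.prems(7) that E1 by auto
        finally show ?thesis .
      qed
    qed (use lpos g less.prems(5) in auto)
    have closed: "perc_sum l E1 (attached_weight D g L P) \<le> exp (\<kappa> * sum l (P \<inter> E1))"
      by (rule IH) auto
    \<comment> \<open>Here \<open>J\<close> consists of the members of the family that contain
      \<open>e\<close>; the others avoid \<open>e\<close> and must be attached to the enlarged
      root.\<close>
    have pw: "attached_weight D g L P (insert e Q)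
        \<le> (\<Sum>J\<in>Pow Le. (\<Prod>C\<in>J. g C) * attached_weight D g (L - Le) (P \<union> (\<Union>C\<in>J. D C)) Q)" for Q
    proof -
      have "attached_weight D g L P (insert e Q) =
        (\<Sum>J\<in>Pow Le. \<Sum>F\<in>Pow (L - Le). of_bool (attached D (insert e Q) P (J \<union> F)) * (\<Prod>C\<in>J \<union> F. g C))"
        unfolding attached_weight_def using fL by (intro sum_Pow_split) (auto simp: Le_def)
      also have "\<dots> \<le> (\<Sum>J\<in>Pow Le. \<Sum>F\<in>Pow (L - Le).
           (\<Prod>C\<in>J. g C) * (of_bool (attached D Q (P \<union> (\<Union>C\<in>J. D C)) F) * (\<Prod>C\<in>F. g C)))"
      proof (intro sum_mono)
        fix J F assume JF: "J \<in> Pow Le" "F \<in> Pow (L - Le)"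
        then have "{C\<in>J \<union> F. e \<in> D C} = J" "J \<union> F - J = F" "finite J" "finite F" "J \<inter> F = {}"
          using fL by (auto simp: Le_def intro: finite_subset)
        moreover have "attached D Q (P \<union> (\<Union>C\<in>J. D C)) F" if "attached D (insert e Q) P (J \<union> F)"
          using attached_insert[OF that] calculation by simp
        ultimately show "of_bool (attached D (insert e Q) P (J \<union> F)) * (\<Prod>C\<in>J \<union> F. g C)
          \<le> (\<Prod>C\<in>J. g C) * (of_bool (attached D Q (P \<union> (\<Union>C\<in>J. D C)) F) * (\<Prod>C\<in>F. g C))"
          using g by (auto simp: prod.union_disjoint intro!: mult_nonneg_nonneg prod_nonneg)
      qed
      finally show ?thesis by (simp add: attached_weight_def sum_distrib_left)
    qed
    have "perc_sum l E1 (\<lambda>Q. attached_weight D g L P (insert e Q)) \<le> 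
      (\<Sum>J\<in>Pow Le. (\<Prod>C\<in>J. g C) * perc_sum l E1 (attached_weight D g (L - Le) (P \<union> (\<Union>C\<in>J. D C))))"
      unfolding perc_sum_cmult[symmetric] perc_sum_sum[symmetric]
      using lpos pw by (intro perc_sum_mono) auto
    also have "\<dots> \<le> (\<Sum>J\<in>Pow Le. (\<Prod>C\<in>J. g C) * exp (\<kappa> * (sum l (P \<inter> E1) + (\<Sum>C\<in>J. d C))))"
    proof (intro sum_mono mult_left_mono)
      fix J assume J: "J \<in> Pow Le"
      then have fJ: "finite J" and JL: "J \<subseteq> L" using fL by (auto simp: Le_def intro: finite_subset)
      have "sum l ((P \<union> (\<Union>C\<in>J. D C)) \<inter> E1) \<le> sum l (P \<inter> E1) + sum l (\<Union>C\<in>J. D C \<inter> E1)"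
      proof -
        have "sum l ((P \<union> (\<Union>C\<in>J. D C)) \<inter> E1) = sum l ((P \<inter> E1) \<union> (\<Union>C\<in>J. D C \<inter> E1))"
          by (rule arg_cong[where f = "sum l"]) auto
        also have "\<dots> \<le> sum l (P \<inter> E1) + sum l (\<Union>C\<in>J. D C \<inter> E1)"
          using E1(3) lpos fJ by (subst sum_Un) (auto intro!: sum_nonneg)
        finally show ?thesis .
      qed
      also have "sum l (\<Union>C\<in>J. D C \<inter> E1) \<le> (\<Sum>C\<in>J. sum l (D C \<inter> E1))"
        using sum_UN_le[of J "\<lambda>C. D C \<inter> E1" l] E1(3) lpos fJ by auto
      also have "\<dots> \<le> (\<Sum>C\<in>J. d C)" using sub JL by (intro sum_mono) auto
      finally have "sum l ((P \<union> (\<Union>C\<in>J. D C)) \<inter> E1) \<le> sum l (P \<inter> E1) + (\<Sum>C\<in>J. d C)" by simp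
      then have "exp (\<kappa> * sum l ((P \<union> (\<Union>C\<in>J. D C)) \<inter> E1)) \<le> exp (\<kappa> * (sum l (P \<inter> E1) + (\<Sum>C\<in>J. d C)))"
        using less.prems(5) by (simp add: mult_left_mono)
      then show "perc_sum l E1 (attached_weight D g (L - Le) (P \<union> (\<Union>C\<in>J. D C))) \<le> exp (\<kappa> * (sum l (P \<inter> E1) + (\<Sum>C\<in>J. d C)))"
        by (rule order_trans[OF IH, rotated]) auto
    qed (use g in \<open>auto intro: prod_nonneg\<close>)
    also have "\<dots> = exp (\<kappa> * sum l (P \<inter> E1)) * (\<Sum>J\<in>Pow Le. \<Prod>C\<in>J. g C * exp (\<kappa> * d C))"
    proof (subst sum_distrib_left[of "exp (\<kappa> * sum l (P \<inter> E1))"], rule sum.cong[OF refl])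
      fix J assume "J \<in> Pow Le"
      then have fJ: "finite J" using fL by (auto simp: Le_def intro: finite_subset)
      show "(\<Prod>C\<in>J. g C) * exp (\<kappa> * (sum l (P \<inter> E1) + (\<Sum>C\<in>J. d C)))
         = exp (\<kappa> * sum l (P \<inter> E1)) * (\<Prod>C\<in>J. g C * exp (\<kappa> * d C))"
        using fJ by (simp add: distrib_left exp_add sum_distrib_left exp_sum prod.distrib)
    qed
    \<comment> \<open>By \<open>sum_Pow_prod\<close> the sum over \<open>J\<close> is the product in
      the last hypothesis.\<close>
    also have "\<dots> \<le> exp (\<kappa> * sum l (P \<inter> E1)) * (1 + \<kappa>)"
      using less.prems(7)[OF e(2)] fL by (intro mult_left_mono) (auto simp: sum_Pow_prod Le_def)
    finally have opened: "perc_sum l E1 (\<lambda>Q. attached_weight D g L P (insert e Q)) \<le> exp (\<kappa> * sum l (P \<inter> E1)) * (1 + \<kappa>)" .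
    have "perc_sum l E (attached_weight D g L P) \<le> exp (- l e) * exp (\<kappa> * sum l (P \<inter> E1)) +
        (1 - exp (- l e)) * (exp (\<kappa> * sum l (P \<inter> E1)) * (1 + \<kappa>))"
      unfolding E1(1) perc_sum_insert[OF E1(3,2)] using closed opened le
      by (intro add_mono mult_left_mono) auto
    also have "\<dots> = exp (\<kappa> * sum l (P \<inter> E1)) * (1 + (1 - exp (- l e)) * \<kappa>)"
      by (simp add: algebra_simps)
    \<comment> \<open>From \<open>1 - exp (- l e) \<le> l e\<close>; the new factor restores the
      weight of \<open>e\<close>, which is missing from \<open>P \<inter> E1\<close>.\<close>
    also have "\<dots> \<le> exp (\<kappa> * sum l (P \<inter> E1)) * exp (l e * \<kappa>)"
    proof (intro mult_left_mono)
      have "1 - exp (- l e) \<le> l e" using exp_ge_add_one_self[of "- l e"] by simp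
      then have "1 + (1 - exp (- l e)) * \<kappa> \<le> 1 + l e * \<kappa>" using less.prems(5) by (simp add: mult_right_mono)
      then show "1 + (1 - exp (- l e)) * \<kappa> \<le> exp (l e * \<kappa>)" using exp_ge_add_one_self[of "l e * \<kappa>"] by linarith
    qed auto
    also have "\<dots> = exp (\<kappa> * sum l (P \<inter> E))"
    proof -
      have "P \<inter> E = insert e (P \<inter> E1)" using E1(1) e by auto
      then show ?thesis using E1 by (simp add: exp_add[symmetric] algebra_simps)
    qed
    finally show ?thesis .
  qed
qed

text \<open>Call a subfamily bad if it has no open link to \<open>P\<close> or to the rest of
  \<open>F\<close>. The union \<open>B\<close> of all bad subfamilies is again bad, and
  \<open>F - B\<close> is attached: an unlinked nonempty part of it could be added to
  \<open>B\<close>.\<close>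

lemma attached_part_exists:
  assumes "finite F"
  obtains F' where "F' \<subseteq> F" "attached D Q P F'"
    "\<forall>C\<in>F - F'. \<forall>e\<in>D C \<inter> Q. e \<notin> P \<and> (\<forall>C'\<in>F'. e \<notin> D C')"
proof -
  define bad where "bad G \<longleftrightarrow> G \<subseteq> F \<and> (\<forall>C\<in>G. \<forall>e\<in>D C \<inter> Q. e \<notin> P \<and> (\<forall>C'\<in>F - G. e \<notin> D C'))" for G
  define B where "B = \<Union>{G. bad G}"
  have badB: "bad B"
    unfolding bad_def
  proof (intro conjI ballI)
    show "B \<subseteq> F" unfolding B_def bad_def by blast
    fix C e assume C: "C \<in> B" and e: "e \<in> D C \<inter> Q"
    then obtain G where G: "bad G" "C \<in> G" unfolding B_def by blast
    then show "e \<notin> P" using e unfolding bad_def by blast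
    fix C' assume "C' \<in> F - B"
    then have "C' \<in> F - G" using G unfolding B_def by blast
    then show "e \<notin> D C'" using e G unfolding bad_def by blast
  qed
  show thesis
  proof
    show "F - B \<subseteq> F" by auto
    show "\<forall>C\<in>F - (F - B). \<forall>e\<in>D C \<inter> Q. e \<notin> P \<and> (\<forall>C'\<in>F - B. e \<notin> D C')"
      using badB unfolding bad_def by blast
    show "attached D Q P (F - B)"
      unfolding attached_def
    proof (intro allI impI, rule ccontr)
      fix G assume G: "G \<subseteq> F - B" "G \<noteq> {}"
        and neg: "\<not> (\<exists>C\<in>G. \<exists>e\<in>D C \<inter> Q. e \<in> P \<or> (\<exists>C'\<in>F - B - G. e \<in> D C'))"
      have "bad (G \<union> B)"
        unfolding bad_def
      proof (intro conjI ballI)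
        show "G \<union> B \<subseteq> F" using G badB unfolding bad_def by blast
        fix C e assume C: "C \<in> G \<union> B" and e: "e \<in> D C \<inter> Q"
        show "e \<notin> P" using C e neg badB unfolding bad_def by blast
        fix C' assume C': "C' \<in> F - (G \<union> B)"
        show "e \<notin> D C'"
        proof (cases "C \<in> G")
          case True
          then show ?thesis using C' e neg by blast
        next
          case False
          then show ?thesis using C C' e badB unfolding bad_def by blast
        qed
      qed
      then have "G \<subseteq> B" unfolding B_def by blast
      then show False using G by blast
    qed
  qed
qed

section \<open>Contraction of a finite network\<close>

definition cut_edges :: "'a set set \<Rightarrow> 'a set \<Rightarrow> 'a set set" where
  "cut_edges E S = {e \<in> E. \<exists>u v. e = {u, v} \<and> u \<in> S \<and> v \<notin> S}"

text \<open>The iterated symmetric difference of \<open>T\<close> with the members of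
  \<open>F\<close>, expressed by parity so that the order of the flips is immaterial.\<close>

definition flip :: "'a set \<Rightarrow> 'a set set \<Rightarrow> 'a set" where
  "flip T F = {v. (v \<in> T) \<noteq> odd (card {C\<in>F. v \<in> C})}"

lemma flip_empty [simp]: "flip T {} = T"
  by (simp add: flip_def)

lemma odd_card_insert_filter:
  assumes "finite F" "C \<notin> F"
  shows "odd (card {C'\<in>insert C F. P C'}) \<longleftrightarrow> odd (card {C'\<in>F. P C'}) \<noteq> P C"
proof -
  have "{C'\<in>insert C F. P C'} = (if P C then insert C {C'\<in>F. P C'} else {C'\<in>F. P C'})" by auto
  then show ?thesis using assms by simp
qed

lemma flip_insert:
  assumes "finite F" "C \<notin> F"
  shows "flip T (insert C F) = sym_diff (flip T F) C"
  unfolding flip_def odd_card_insert_filter[OF assms] by auto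

lemma doubleton_in_cut_edges_iff:
  "{u, v} \<in> cut_edges E S \<longleftrightarrow> {u, v} \<in> E \<and> (u \<in> S) \<noteq> (v \<in> S)"
  unfolding cut_edges_def by (auto simp: doubleton_eq_iff)

lemma partition_on_blocks:
  assumes "partition_on W \<P>" "B \<in> \<P>"
  shows "B \<noteq> {}" "B \<subseteq> W"
  using assms unfolding partition_on_def by auto

lemma partition_on_disjoint_blocks:
  assumes "partition_on W \<P>" "B \<in> \<P>" "B' \<in> \<P>" "B \<noteq> B'"
  shows "B \<inter> B' = {}"
  using assms unfolding partition_on_def disjoint_def by simp

text \<open>
  The cuts of interest contain the source \<open>x\<close> and avoid the set of sinks \<open>Y\<close>. The value \<open>\<eta> n\<close> bounds the inverse
  boundary weight of sets of size \<open>n\<close>, and \<open>\<tau> n\<close> bounds the sum of \<open>\<eta>\<close> over the sizes that a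
  block of size \<open>n\<close> can still pass through, given that each merge at least doubles the size. Sets of
  more than \<open>m\<close> vertices have no isoperimetric bound, and at most one block can be that large.
\<close>

locale cut_network =
  fixes W Y :: "'a set" and x :: 'a and E :: "'a set set" and l :: "'a set \<Rightarrow> real"
    and m :: nat and \<eta> \<tau> :: "nat \<Rightarrow> real"
  assumes finite_W: "finite W"
    and finite_E: "finite E"
    and edge: "\<And>e. e \<in> E \<Longrightarrow> \<exists>u v. e = {u, v} \<and> u \<in> W \<and> v \<in> W"
    and l_nonneg: "\<And>e. e \<in> E \<Longrightarrow> 0 \<le> l e"
    and source: "x \<in> W - Y"
    and eta_nonneg: "\<And>n. 0 \<le> \<eta> n"
    and tau_nonneg: "\<And>n. 0 \<le> \<tau> n"
    and tau_antimono: "\<And>n n'. n \<le> n' \<Longrightarrow> \<tau> n' \<le> \<tau> n"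
    and tau_drop: "\<And>n n'. 1 \<le> n \<Longrightarrow> n \<le> m \<Longrightarrow> 2 * n \<le> n' \<Longrightarrow> \<tau> n' + \<eta> n \<le> \<tau> n"
    and isoperimetry: "\<And>C. C \<subseteq> W - Y \<Longrightarrow> x \<notin> C \<Longrightarrow> C \<noteq> {} \<Longrightarrow> card C \<le> m
        \<Longrightarrow> 1 \<le> \<eta> (card C) * sum l (cut_edges E C)"
    and card_W: "card W < 2 * m + 2"
begin

abbreviation "bd \<equiv> cut_edges E"
abbreviation "wt \<equiv> sum l"

lemma bd_subset: "bd S \<subseteq> E"
  by (auto simp: cut_edges_def)

lemma finite_bd [simp]: "finite (bd S)"
  using finite_E bd_subset by (rule rev_finite_subset)

lemma l_nonneg_bd: "e \<in> bd S \<Longrightarrow> 0 \<le> l e"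
  using l_nonneg bd_subset by blast

lemma wt_nonneg: "D \<subseteq> E \<Longrightarrow> 0 \<le> wt D"
  by (auto intro!: sum_nonneg l_nonneg)

lemma wt_mono: "D \<subseteq> D' \<Longrightarrow> D' \<subseteq> E \<Longrightarrow> wt D \<le> wt D'"
  using finite_E by (intro sum_mono2) (auto intro: finite_subset[OF _ finite_E] l_nonneg)

lemma bd_sym_diff: "bd (sym_diff S C) = sym_diff (bd S) (bd C)"
proof (intro set_eqI)
  fix e show "e \<in> bd (sym_diff S C) \<longleftrightarrow> e \<in> sym_diff (bd S) (bd C)"
  proof (cases "e \<in> E")
    case True
    then obtain u v where "e = {u, v}" using edge by blast
    then show ?thesis by (auto simp: doubleton_in_cut_edges_iff)
  qed (auto simp: cut_edges_def)
qed

text \<open>By \<open>bd_sym_diff\<close> the boundary map is additive modulo 2.\<close>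

lemma bd_flip:
  assumes "finite F"
  shows "e \<in> bd (flip T F) \<longleftrightarrow> (e \<in> bd T) \<noteq> odd (card {C\<in>F. e \<in> bd C})"
  using assms
proof (induction F rule: finite_induct)
  case (insert C F)
  then show ?case
    by (subst flip_insert, simp, simp, subst bd_sym_diff, subst odd_card_insert_filter) auto
qed simp

lemma bd_union_subset: "bd (A \<union> B) \<subseteq> bd A \<union> bd B"
  by (auto simp: cut_edges_def)

text \<open>An edge lies in the boundary of at most two blocks, those of its endpoints.\<close>

lemma sum_wt_blocks_le:
  assumes P: "partition_on W \<P>" and D: "D \<subseteq> E"
  shows "(\<Sum>B\<in>\<P>. wt (bd B \<inter> D)) \<le> 2 * wt D"
proof -
  have fP: "finite \<P>" using finite_elements[OF finite_W P] .
  have fD: "finite D" using D finite_E by (rule finite_subset)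
  have "(\<Sum>B\<in>\<P>. wt (bd B \<inter> D)) = (\<Sum>B\<in>\<P>. \<Sum>e\<in>D. if e \<in> bd B then l e else 0)"
    by (rule sum.cong[OF refl], subst Int_commute, rule sum.inter_restrict[OF fD])
  also have "\<dots> = (\<Sum>e\<in>D. \<Sum>B\<in>\<P>. if e \<in> bd B then l e else 0)"
    by (rule sum.swap)
  also have "\<dots> \<le> (\<Sum>e\<in>D. 2 * l e)"
  proof (rule sum_mono)
    fix e assume "e \<in> D"
    then have eE: "e \<in> E" using D by auto
    then obtain u v where e: "e = {u, v}" "u \<in> W" "v \<in> W" using edge by blast
    obtain Bu Bv where B: "Bu \<in> \<P>" "Bv \<in> \<P>" "u \<in> Bu" "v \<in> Bv"
      using P e(2,3) unfolding partition_on_def by blast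
    have un: "B = B'" if "B \<in> \<P>" "B' \<in> \<P>" "w \<in> B" "w \<in> B'" for B B' w
      using partition_on_disjoint_blocks[OF P that(1,2)] that(3,4) by auto
    have "{B\<in>\<P>. e \<in> bd B} \<subseteq> {Bu, Bv}"
      using un B unfolding e(1) doubleton_in_cut_edges_iff by blast
    then have "card {B\<in>\<P>. e \<in> bd B} \<le> card {Bu, Bv}" by (intro card_mono) auto
    also have "\<dots> \<le> 2" by (simp add: card_insert_if)
    finally have "card {B\<in>\<P>. e \<in> bd B} \<le> 2" .
    then have "real (card {B\<in>\<P>. e \<in> bd B}) * l e \<le> 2 * l e"
      using l_nonneg[OF eE] by (intro mult_right_mono) auto
    then show "(\<Sum>B\<in>\<P>. if e \<in> bd B then l e else 0) \<le> 2 * l e"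
      using fP by (simp add: sum.inter_filter[symmetric])
  qed
  finally show ?thesis by (simp add: sum_distrib_left)
qed

section \<open>Active blocks and the cost potential\<close>

definition active :: "'a set \<Rightarrow> bool" where
  "active B \<longleftrightarrow> B \<subseteq> W - Y \<and> x \<notin> B \<and> B \<noteq> {} \<and> card B \<le> m"

text \<open>A bound for the sum of \<open>\<eta>\<close> over the merges in which the block
  containing a vertex of \<open>B\<close> is the smallest active one, from the present stage on. It
  vanishes for blocks that are never chosen as the smallest.\<close>

definition rate :: "'a set \<Rightarrow> real" where
  "rate B = (if active B then \<tau> (card B) else 0)"

text \<open>In the randomised picture \<open>exp (- cost \<P> S)\<close> is a lower bound for the
  probability that the contraction started at \<open>\<P>\<close> respects \<open>S\<close>, up to
  flips. The factor 2 comes from \<open>one_le_exp_twice\<close>.\<close>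

definition cost :: "'a set set \<Rightarrow> 'a set \<Rightarrow> real" where
  "cost \<P> S = (\<Sum>B\<in>\<P>. 2 * rate B * wt (bd B \<inter> bd S))"

lemma rate_nonneg: "0 \<le> rate B"
  by (simp add: rate_def tau_nonneg)

lemma active_card_pos: "active B \<Longrightarrow> 1 \<le> card B"
  unfolding active_def by (auto simp: Suc_le_eq card_gt_0_iff intro: finite_subset[OF _ finite_W])

lemma active_wt_pos:
  assumes "active C"
  shows "1 \<le> \<eta> (card C) * wt (bd C)" and "0 < wt (bd C)"
proof -
  show 1: "1 \<le> \<eta> (card C) * wt (bd C)" using isoperimetry assms unfolding active_def by blast
  have "0 \<le> wt (bd C)" using wt_nonneg bd_subset by blast
  moreover have "wt (bd C) \<noteq> 0" using 1 by auto
  ultimately show "0 < wt (bd C)" by linarith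
qed

text \<open>If the union is still active then so is \<open>B\<close>, hence \<open>B\<close> is no
  smaller than \<open>C\<close> and the size of the block of \<open>C\<close> at least doubles, so
  \<open>tau_drop\<close> applies.\<close>

lemma rate_merge:
  assumes C: "active C" and B: "B \<noteq> {}" "B \<subseteq> W" "C \<inter> B = {}" and min: "active B \<Longrightarrow> card C \<le> card B"
  shows "rate (C \<union> B) \<le> rate B" "rate (C \<union> B) + \<eta> (card C) \<le> rate C"
proof -
  have n: "1 \<le> card C" "card C \<le> m" using active_card_pos[OF C] C by (auto simp: active_def)
  have fin: "finite C" "finite B" using C B by (auto simp: active_def intro: finite_subset[OF _ finite_W])
  have "rate (C \<union> B) \<le> rate B \<and> rate (C \<union> B) + \<eta> (card C) \<le> rate C"
  proof (cases "active (C \<union> B)")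
    case True
    then have aB: "active B" using B fin card_mono[of "C \<union> B" B] by (auto simp: active_def)
    have "card (C \<union> B) = card C + card B" using fin B by (simp add: card_Un_disjoint)
    then have "2 * card C \<le> card (C \<union> B)" "card B \<le> card (C \<union> B)" using min[OF aB] by auto
    then show ?thesis using True aB C tau_drop[OF n] tau_antimono by (simp add: rate_def)
  next
    case False
    \<comment> \<open>An inactive union has rate 0, and it remains to see that \<open>\<tau>\<close>
      dominates \<open>\<eta>\<close> at \<open>card C\<close>.\<close>
    have "\<tau> (2 * card C) + \<eta> (card C) \<le> \<tau> (card C)" using tau_drop[OF n] by simp
    then have "\<eta> (card C) \<le> \<tau> (card C)" using tau_nonneg[of "2 * card C"] by linarith
    then show ?thesis using False C rate_nonneg[of B] by (simp add: rate_def)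
  qed
  then show "rate (C \<union> B) \<le> rate B" "rate (C \<union> B) + \<eta> (card C) \<le> rate C" by auto
qed

lemma partition_on_merge:
  assumes "partition_on W \<P>" "C \<in> \<P>" "B \<in> \<P>"
  shows "partition_on W (insert (C \<union> B) (\<P> - {C, B}))"
proof (rule partition_onI)
  note un = partition_on_disjoint_blocks[OF assms(1)]
  fix p q assume pq: "p \<in> insert (C \<union> B) (\<P> - {C, B})" "q \<in> insert (C \<union> B) (\<P> - {C, B})" "p \<noteq> q"
  have one: "(C \<union> B) \<inter> q = {}" if "q \<in> \<P> - {C, B}" for q
    using un[of C q] un[of B q] assms(2,3) that by auto
  consider "p = C \<union> B" "q \<in> \<P> - {C, B}" | "q = C \<union> B" "p \<in> \<P> - {C, B}" | "p \<in> \<P>" "q \<in> \<P>"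
    using pq by blast
  then show "disjnt p q"
  proof cases
    case 1
    then show ?thesis using one by (simp add: disjnt_def)
  next
    case 2
    then show ?thesis using one by (simp add: disjnt_def Int_commute)
  next
    case 3
    then show ?thesis using un pq(3) by (simp add: disjnt_def)
  qed
next
  show "\<Union> (insert (C \<union> B) (\<P> - {C, B})) = W"
    using assms unfolding partition_on_def by auto
  show "{} \<notin> insert (C \<union> B) (\<P> - {C, B})"
    using assms unfolding partition_on_def by auto
qed

text \<open>Each edge in the boundary of \<open>C \<union> B\<close> was already charged to
  \<open>C\<close> or to \<open>B\<close>, and the rate of \<open>C\<close> drops by
  \<open>\<eta> (card C)\<close>. This drop pays for the risk that the merging edge is cut by
  \<open>S\<close>.\<close>

lemma cost_merge:
  assumes P: "partition_on W \<P>" and C: "C \<in> \<P>" "active C" and B: "B \<in> \<P>" "B \<noteq> C"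
    and min: "\<And>B. B \<in> \<P> \<Longrightarrow> active B \<Longrightarrow> card C \<le> card B"
  shows "cost (insert (C \<union> B) (\<P> - {C, B})) S + 2 * \<eta> (card C) * wt (bd C \<inter> bd S) \<le> cost \<P> S"
proof -
  have fP: "finite \<P>" using finite_elements[OF finite_W P] .
  have BC: "B \<noteq> {}" "B \<subseteq> W" "C \<inter> B = {}" "C \<noteq> {}"
    using partition_on_blocks[OF P] partition_on_disjoint_blocks[OF P] C(1) B by auto
  note rm = rate_merge[OF C(2) BC(1-3) min[OF B(1)]]
  let ?w = "\<lambda>B. wt (bd B \<inter> bd S)"
  have "C \<union> B \<notin> \<P> - {C, B}"
  proof
    assume "C \<union> B \<in> \<P> - {C, B}"
    then have "(C \<union> B) \<inter> C = {}" using partition_on_disjoint_blocks[OF P, of "C \<union> B" C] C by auto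
    then show False using BC by auto
  qed
  then have "cost (insert (C \<union> B) (\<P> - {C, B})) S
      = 2 * rate (C \<union> B) * ?w (C \<union> B) + (\<Sum>B\<in>\<P> - {C, B}. 2 * rate B * ?w B)"
    using fP by (simp add: cost_def)
  moreover have "cost \<P> S = 2 * rate C * ?w C + 2 * rate B * ?w B + (\<Sum>B\<in>\<P> - {C, B}. 2 * rate B * ?w B)"
  proof -
    have "\<P> = insert C (insert B (\<P> - {C, B}))" using C B by auto
    then have "cost \<P> S = (\<Sum>B\<in>insert C (insert B (\<P> - {C, B})). 2 * rate B * ?w B)"
      unfolding cost_def by simp
    also have "\<dots> = 2 * rate C * ?w C + 2 * rate B * ?w B + (\<Sum>B\<in>\<P> - {C, B}. 2 * rate B * ?w B)"
      using fP B by (subst sum.insert, simp, simp) (simp add: add.assoc)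
    finally show ?thesis .
  qed
  moreover have "2 * rate (C \<union> B) * ?w (C \<union> B) + 2 * \<eta> (card C) * ?w C \<le> 2 * rate C * ?w C + 2 * rate B * ?w B"
  proof -
    have nn: "0 \<le> ?w C" "0 \<le> ?w B" using bd_subset by (auto intro!: wt_nonneg)
    have "?w (C \<union> B) \<le> wt ((bd C \<inter> bd S) \<union> (bd B \<inter> bd S))"
      using bd_union_subset[of C B] bd_subset by (intro wt_mono) auto
    also have "\<dots> \<le> ?w C + ?w B"
      using bd_subset[of S] by (subst sum_Un) (auto intro!: wt_nonneg)
    finally have "rate (C \<union> B) * ?w (C \<union> B) \<le> rate (C \<union> B) * ?w C + rate (C \<union> B) * ?w B"
      using rate_nonneg by (metis distrib_left mult_left_mono)
    moreover have "(rate (C \<union> B) + \<eta> (card C)) * ?w C \<le> rate C * ?w C" using rm nn by (intro mult_right_mono) auto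
    moreover have "rate (C \<union> B) * ?w B \<le> rate B * ?w B" using rm nn by (intro mult_right_mono) auto
    ultimately show ?thesis by (simp add: algebra_simps)
  qed
  ultimately show ?thesis by linarith
qed

text \<open>Flipping exchanges \<open>bd S \<inter> bd C\<close> for \<open>bd C - bd S\<close>. The
  removed part saves at least \<open>2 * \<tau> (card C) * (3/4) * wt (bd C)\<close> through the
  block \<open>C\<close> alone. The added part has weight at most \<open>wt (bd C) / 4\<close> and
  is charged to at most two blocks; as \<open>C\<close> is the smallest active block, no rate
  exceeds \<open>\<tau> (card C)\<close>, so the increase is at most
  \<open>\<tau> (card C) * wt (bd C)\<close>.\<close>

lemma cost_flip:
  assumes P: "partition_on W \<P>" and C: "C \<in> \<P>" "active C"
    and min: "\<And>B. B \<in> \<P> \<Longrightarrow> active B \<Longrightarrow> card C \<le> card B"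
    and bad: "3 / 4 * wt (bd C) \<le> wt (bd C \<inter> bd S)"
  shows "cost \<P> (sym_diff S C) \<le> cost \<P> S"
proof -
  have fP: "finite \<P>" using finite_elements[OF finite_W P] .
  have rl: "rate B \<le> \<tau> (card C)" if "B \<in> \<P>" for B
    using min[OF that] tau_antimono tau_nonneg by (simp add: rate_def)
  have split: "wt (bd B \<inter> bd (sym_diff S C)) = wt (bd B \<inter> bd S) - wt (bd B \<inter> (bd S \<inter> bd C)) + wt (bd B \<inter> (bd C - bd S))" for B
  proof -
    have "wt (bd B \<inter> bd S) = wt (bd B \<inter> (bd S \<inter> bd C)) + wt (bd B \<inter> (bd S - bd C))"
      using sum.Int_Diff[of "bd B \<inter> bd S" l "bd C"] by (simp add: Int_assoc Int_Diff)
    moreover have "wt (bd B \<inter> bd (sym_diff S C)) = wt (bd B \<inter> (bd S - bd C)) + wt (bd B \<inter> (bd C - bd S))"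
      unfolding bd_sym_diff Int_Un_distrib by (rule sum.union_disjoint) auto
    ultimately show ?thesis by simp
  qed
  have "cost \<P> (sym_diff S C) = cost \<P> S - (\<Sum>B\<in>\<P>. 2 * rate B * wt (bd B \<inter> (bd S \<inter> bd C)))
      + (\<Sum>B\<in>\<P>. 2 * rate B * wt (bd B \<inter> (bd C - bd S)))"
    unfolding cost_def split by (simp add: algebra_simps sum.distrib sum_subtractf)
  moreover have "2 * \<tau> (card C) * (3 / 4 * wt (bd C)) \<le> (\<Sum>B\<in>\<P>. 2 * rate B * wt (bd B \<inter> (bd S \<inter> bd C)))"
  proof -
    have "2 * \<tau> (card C) * (3 / 4 * wt (bd C)) \<le> 2 * rate C * wt (bd C \<inter> (bd S \<inter> bd C))"
    proof -
      have "bd C \<inter> (bd S \<inter> bd C) = bd C \<inter> bd S" by auto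
      moreover have "rate C = \<tau> (card C)" using C by (simp add: rate_def)
      ultimately show ?thesis using mult_left_mono[OF bad, of "2 * \<tau> (card C)"] tau_nonneg by simp
    qed
    also have "\<dots> \<le> (\<Sum>B\<in>\<P>. 2 * rate B * wt (bd B \<inter> (bd S \<inter> bd C)))"
      using C fP rate_nonneg bd_subset by (intro member_le_sum) (auto intro!: mult_nonneg_nonneg wt_nonneg)
    finally show ?thesis .
  qed
  moreover have "(\<Sum>B\<in>\<P>. 2 * rate B * wt (bd B \<inter> (bd C - bd S))) \<le> 2 * \<tau> (card C) * (2 * (1 / 4 * wt (bd C)))"
  proof -
    have "wt (bd C) = wt (bd C \<inter> bd S) + wt (bd C - bd S)"
      by (rule sum.Int_Diff) simp
    then have le: "wt (bd C - bd S) \<le> 1 / 4 * wt (bd C)" using bad by simp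
    have "(\<Sum>B\<in>\<P>. 2 * rate B * wt (bd B \<inter> (bd C - bd S))) \<le> (\<Sum>B\<in>\<P>. 2 * \<tau> (card C) * wt (bd B \<inter> (bd C - bd S)))"
      using rl bd_subset by (intro sum_mono mult_right_mono) (auto intro!: wt_nonneg)
    also have "\<dots> = 2 * \<tau> (card C) * (\<Sum>B\<in>\<P>. wt (bd B \<inter> (bd C - bd S)))"
      by (simp add: sum_distrib_left)
    also have "\<dots> \<le> 2 * \<tau> (card C) * (2 * wt (bd C - bd S))"
      using bd_subset tau_nonneg by (intro mult_left_mono sum_wt_blocks_le[OF P]) auto
    also have "\<dots> \<le> 2 * \<tau> (card C) * (2 * (1 / 4 * wt (bd C)))"
      using le tau_nonneg by (intro mult_left_mono) auto
    finally show ?thesis .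
  qed
  moreover have "0 \<le> \<tau> (card C) * wt (bd C)" using tau_nonneg active_wt_pos[OF C(2)] by simp
  ultimately show ?thesis by (simp add: algebra_simps)
qed

section \<open>Encoding of cuts by flips of terminal cuts\<close>

definition admissible :: "'a set \<Rightarrow> bool" where
  "admissible S \<longleftrightarrow> x \<in> S \<and> S \<subseteq> W - Y"

definition union_of_blocks :: "'a set set \<Rightarrow> 'a set \<Rightarrow> bool" where
  "union_of_blocks \<P> S \<longleftrightarrow> (\<forall>B\<in>\<P>. B \<subseteq> S \<or> B \<inter> S = {})"

text \<open>The divisor 2 arises because a flip takes place only when more than 3/4 of the weight of
  \<open>bd C\<close> is cut: the flip removes this part and adds less than 1/4.\<close>

definition represented :: "'a set set \<Rightarrow> 'a set set \<Rightarrow> 'a set \<Rightarrow> bool" where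
  "represented L \<T> S \<longleftrightarrow> (\<exists>T\<in>\<T>. \<exists>F\<subseteq>L. S = flip T F \<and>
      wt (bd T) + (\<Sum>C\<in>F. wt (bd C)) / 2 \<le> wt (bd S))"

text \<open>The record of a contraction started at \<open>\<P>\<close>: \<open>L\<close> collects
  the successive smallest blocks, \<open>\<T>\<close> the cuts left at the end. The sum over the
  members of \<open>L\<close> above \<open>B\<close> measures how densely \<open>L\<close> covers
  \<open>B\<close>; from singletons it yields the bound \<open>\<tau> 1\<close> at every
  vertex.\<close>

definition hierarchy :: "'a set set \<Rightarrow> 'a set set \<Rightarrow> 'a set set \<Rightarrow> bool" where
  "hierarchy \<P> L \<T> \<longleftrightarrow> finite L \<and> (\<forall>C\<in>L. active C \<and> union_of_blocks \<P> C) \<and>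
     (\<forall>B\<in>\<P>. (\<Sum>C\<in>{C\<in>L. B \<subseteq> C}. \<eta> (card C)) \<le> rate B) \<and>
     finite \<T> \<and> card \<T> \<le> 2 \<and> (\<forall>T\<in>\<T>. admissible T)"

end

text \<open>Converts the fraction \<open>1 - r\<close> of usable edges into a factor
  \<open>exp (- 2 * r)\<close>. After replacing \<open>exp r\<close> by its quadratic Taylor
  polynomial, the claim is that a polynomial is nonnegative, which holds up to the flipping
  threshold 3/4.\<close>

lemma one_le_exp_twice:
  fixes r :: real
  assumes "0 \<le> r" "r \<le> 3 / 4"
  shows "1 \<le> (1 - r) * exp (2 * r)"
proof -
  have "r ^ k \<le> (3 / 4) ^ k" for k using assms by (intro power_mono) auto
  from this[of 2] this[of 3] this[of 4] have "0 \<le> r * (1 - r ^ 2 - 3 / 4 * r ^ 3 - 1 / 4 * r ^ 4)"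
    using assms by (intro mult_nonneg_nonneg) (auto simp: power_numeral_reduce)
  also have "\<dots> = (1 - r) * (1 + r + r\<^sup>2 / 2)\<^sup>2 - 1"
    by (simp add: power_numeral_reduce field_simps)
  finally have "1 \<le> (1 - r) * (1 + r + r\<^sup>2 / 2)\<^sup>2" by simp
  also have "\<dots> \<le> (1 - r) * (exp r)\<^sup>2"
    using exp_lower_Taylor_quadratic[OF assms(1)] assms by (intro mult_left_mono power_mono) auto
  also have "(exp r)\<^sup>2 = exp (2 * r)" by (simp add: power2_eq_square exp_add[symmetric])
  finally show ?thesis .
qed

section \<open>Construction of the hierarchy\<close>

context cut_network
begin

text \<open>First moment argument. A random edge of \<open>bd C\<close>, chosen proportionally to
  \<open>l\<close>, avoids \<open>bd (s i)\<close> with probability \<open>1 - r\<close>, which is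
  at least \<open>exp (- 2 * r)\<close>, and the merge lowers the cost of \<open>s i\<close> by at
  least \<open>2 * r\<close>. Hence the expected surviving weight is no smaller than the initial
  one, and some edge attains this.\<close>

lemma hierarchy_step_exists:
  fixes s :: "'i \<Rightarrow> 'a set"
  assumes P: "partition_on W \<P>" and C: "C \<in> \<P>" "active C"
    and min: "\<And>B. B \<in> \<P> \<Longrightarrow> active B \<Longrightarrow> card C \<le> card B"
    and I: "finite I" "\<And>i. i \<in> I \<Longrightarrow> 0 \<le> v i"
    and light: "\<And>i. i \<in> I \<Longrightarrow> wt (bd C \<inter> bd (s i)) \<le> 3 / 4 * wt (bd C)"
  obtains B where "B \<in> \<P>" "B \<noteq> C"
    "(\<Sum>i\<in>I. v i * exp (- cost \<P> (s i))) \<le>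
      (\<Sum>i\<in>{i\<in>I. \<exists>e\<in>bd C - bd (s i). \<exists>u w. e = {u, w} \<and> u \<in> C \<and> w \<in> B}.
         v i * exp (- cost (insert (C \<union> B) (\<P> - {C, B})) (s i)))"
proof -
  define good where "good e B \<longleftrightarrow> B \<in> \<P> \<and> B \<noteq> C \<and> (\<exists>u w. e = {u, w} \<and> u \<in> C \<and> w \<in> B)" for e B
  have ex: "\<exists>B. good e B" if eC: "e \<in> bd C" for e
  proof -
    obtain u w where e: "e = {u, w}" "u \<in> C" "w \<notin> C" "e \<in> E" using eC unfolding cut_edges_def by blast
    then have "w \<in> W" using edge[of e] by (auto simp: doubleton_eq_iff)
    then obtain B where "B \<in> \<P>" "w \<in> B" using P unfolding partition_on_def by blast
    then show ?thesis using e unfolding good_def by blast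
  qed
  \<comment> \<open>The block at the far end of \<open>e\<close>, with which \<open>C\<close> would
    be merged.\<close>
  define nb where "nb e = (SOME B. good e B)" for e
  have nb: "good e (nb e)" if "e \<in> bd C" for e
    unfolding nb_def using ex[OF that] by (rule someI_ex)
  define \<Lambda> where "\<Lambda> = wt (bd C)"
  have Lpos: "0 < \<Lambda>" "1 \<le> \<eta> (card C) * \<Lambda>" using active_wt_pos[OF C(2)] by (auto simp: \<Lambda>_def)
  define c where "c B i = exp (- cost (insert (C \<union> B) (\<P> - {C, B})) (s i))" for B i
  define t where "t = (\<Sum>i\<in>I. v i * exp (- cost \<P> (s i)))"
  define f where "f e = (\<Sum>i\<in>I. if e \<in> bd (s i) then 0 else v i * c (nb e) i)" for e
  have point: "exp (- cost \<P> (s i)) * \<Lambda> \<le> (\<Sum>e\<in>bd C. l e * (if e \<in> bd (s i) then 0 else c (nb e) i))"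
    if i: "i \<in> I" for i
  proof -
    define r where "r = wt (bd C \<inter> bd (s i)) / \<Lambda>"
    have r: "0 \<le> r" "r \<le> 3 / 4"
      using light[OF i] Lpos wt_nonneg[of "bd C \<inter> bd (s i)"] bd_subset
      by (auto simp: r_def \<Lambda>_def divide_simps)
    have rest: "wt (bd C - bd (s i)) = \<Lambda> * (1 - r)"
    proof -
      have "\<Lambda> = wt (bd C \<inter> bd (s i)) + wt (bd C - bd (s i))"
        unfolding \<Lambda>_def by (rule sum.Int_Diff) simp
      moreover have "\<Lambda> * r = wt (bd C \<inter> bd (s i))" using Lpos by (simp add: r_def)
      ultimately show ?thesis by (simp add: right_diff_distrib)
    qed
    have cl: "exp (- cost \<P> (s i)) * exp (2 * r) \<le> c (nb e) i" if "e \<in> bd C" for e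
    proof -
      have "nb e \<in> \<P>" "nb e \<noteq> C" using nb[OF that] by (auto simp: good_def)
      note cm = cost_merge[OF P C this min, of "s i"]
      \<comment> \<open>Isoperimetry enters here: \<open>\<Lambda>\<close> is the weight of
        \<open>bd C\<close>, so \<open>1 \<le> \<eta> (card C) * \<Lambda>\<close>.\<close>
      have "r \<le> \<eta> (card C) * wt (bd C \<inter> bd (s i))"
      proof -
        have "r * 1 \<le> r * (\<eta> (card C) * \<Lambda>)" using r Lpos by (intro mult_left_mono) auto
        also have "\<dots> = \<eta> (card C) * wt (bd C \<inter> bd (s i))" using Lpos by (simp add: r_def)
        finally show ?thesis by simp
      qed
      then have "- cost \<P> (s i) + 2 * r \<le> - cost (insert (C \<union> nb e) (\<P> - {C, nb e})) (s i)"
        using cm by linarith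
      then show ?thesis unfolding c_def exp_add[symmetric] by simp
    qed
    have "exp (- cost \<P> (s i)) * \<Lambda> * 1 \<le> exp (- cost \<P> (s i)) * \<Lambda> * ((1 - r) * exp (2 * r))"
      using one_le_exp_twice[OF r] Lpos by (intro mult_left_mono) auto
    also have "\<dots> = wt (bd C - bd (s i)) * (exp (- cost \<P> (s i)) * exp (2 * r))"
      unfolding rest by simp
    also have "\<dots> \<le> (\<Sum>e\<in>bd C - bd (s i). l e * c (nb e) i)"
      unfolding sum_distrib_right using cl l_nonneg_bd by (intro sum_mono mult_left_mono) auto
    also have "\<dots> = (\<Sum>e\<in>bd C. l e * (if e \<in> bd (s i) then 0 else c (nb e) i))"
      by (intro sum.mono_neutral_cong_left) auto
    finally show ?thesis by simp
  qed
  have "t * \<Lambda> = (\<Sum>i\<in>I. v i * (exp (- cost \<P> (s i)) * \<Lambda>))"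
    unfolding t_def sum_distrib_right by (simp add: mult_ac)
  also have "\<dots> \<le> (\<Sum>i\<in>I. v i * (\<Sum>e\<in>bd C. l e * (if e \<in> bd (s i) then 0 else c (nb e) i)))"
    using point I by (intro sum_mono mult_left_mono) auto
  also have "\<dots> = (\<Sum>i\<in>I. \<Sum>e\<in>bd C. l e * (if e \<in> bd (s i) then 0 else v i * c (nb e) i))"
    unfolding sum_distrib_left by (intro sum.cong refl) (simp add: mult_ac)
  also have "\<dots> = (\<Sum>e\<in>bd C. l e * f e)"
    unfolding f_def sum_distrib_left by (rule sum.swap)
  finally have avg: "t * \<Lambda> \<le> (\<Sum>e\<in>bd C. l e * f e)" .
  \<comment> \<open>Otherwise the weighted mean of \<open>f\<close> would be below \<open>t\<close>;
    an edge \<open>e0\<close> of positive weight makes the inequality strict.\<close>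
  have "\<exists>e\<in>bd C. t \<le> f e"
  proof (rule ccontr)
    assume "\<not> (\<exists>e\<in>bd C. t \<le> f e)"
    then have lt: "\<And>e. e \<in> bd C \<Longrightarrow> f e < t" by auto
    obtain e0 where e0: "e0 \<in> bd C" "0 < l e0"
    proof (rule ccontr)
      assume "\<not> thesis"
      then have "wt (bd C) \<le> 0" using that by (intro sum_nonpos) (meson not_less)
      then show False using Lpos by (simp add: \<Lambda>_def)
    qed
    have "(\<Sum>e\<in>bd C. l e * f e) < (\<Sum>e\<in>bd C. l e * t)"
    proof (rule sum_strict_mono_ex1)
      show "\<forall>e\<in>bd C. l e * f e \<le> l e * t" by (intro ballI mult_left_mono less_imp_le[OF lt] l_nonneg_bd)
      show "\<exists>e\<in>bd C. l e * f e < l e * t" using lt e0 by (intro bexI[of _ e0]) auto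
    qed simp
    also have "\<dots> = t * \<Lambda>" by (simp add: \<Lambda>_def sum_distrib_left mult.commute)
    finally show False using avg by simp
  qed
  then obtain e where e: "e \<in> bd C" "t \<le> f e" by blast
  show thesis
  proof (rule that)
    show B: "nb e \<in> \<P>" "nb e \<noteq> C" using nb[OF e(1)] by (auto simp: good_def)
    have "f e = (\<Sum>i\<in>{i\<in>I. e \<notin> bd (s i)}. v i * c (nb e) i)"
      unfolding f_def using I(1) by (intro sum.mono_neutral_cong_right) auto
    also have "\<dots> \<le> (\<Sum>i\<in>{i \<in> I. \<exists>e'\<in>bd C - bd (s i). \<exists>u w. e' = {u, w} \<and> u \<in> C \<and> w \<in> nb e}. v i * c (nb e) i)"
    proof (rule sum_mono2)
      show "{i\<in>I. e \<notin> bd (s i)} \<subseteq> {i \<in> I. \<exists>e'\<in>bd C - bd (s i). \<exists>u w. e' = {u, w} \<and> u \<in> C \<and> w \<in> nb e}"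
        using nb[OF e(1)] e(1) unfolding good_def by blast
    qed (use I in \<open>auto simp: c_def\<close>)
    finally show "(\<Sum>i\<in>I. v i * exp (- cost \<P> (s i))) \<le>
      (\<Sum>i\<in>{i\<in>I. \<exists>e'\<in>bd C - bd (s i). \<exists>u w. e' = {u, w} \<and> u \<in> C \<and> w \<in> nb e}.
         v i * exp (- cost (insert (C \<union> nb e) (\<P> - {C, nb e})) (s i)))"
      using e(2) unfolding t_def c_def by linarith
  qed
qed

text \<open>Passing back to the finer partition. The members of \<open>L\<close> are unions of
  coarser blocks, so they contain both or neither of \<open>C\<close> and \<open>B\<close>;
  therefore only the block \<open>C\<close> gains a new set above it, and \<open>rate_merge\<close>
  leaves room for its contribution \<open>\<eta> (card C)\<close>.\<close>

lemma hierarchy_merge: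
  assumes P: "partition_on W \<P>" and C: "C \<in> \<P>" "active C"
    and min: "\<And>B. B \<in> \<P> \<Longrightarrow> active B \<Longrightarrow> card C \<le> card B"
    and B: "B \<in> \<P>" "B \<noteq> C"
    and H: "hierarchy (insert (C \<union> B) (\<P> - {C, B})) L \<T>"
  shows "hierarchy \<P> (insert C L) \<T>" "C \<notin> L"
proof -
  have BC: "B \<noteq> {}" "B \<subseteq> W" "C \<inter> B = {}" "C \<noteq> {}"
    using partition_on_blocks[OF P] partition_on_disjoint_blocks[OF P] C(1) B by auto
  note disj = partition_on_disjoint_blocks[OF P]
  note rm = rate_merge[OF C(2) BC(1-3) min[OF B(1)]]
  have fL: "finite L" and L: "\<And>C'. C' \<in> L \<Longrightarrow> active C'"
    and T: "finite \<T>" "card \<T> \<le> 2" "\<forall>T\<in>\<T>. admissible T"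
    using H by (simp_all add: hierarchy_def)
  have U: "B' \<subseteq> C' \<or> B' \<inter> C' = {}" if "C' \<in> L" "B' \<in> insert (C \<union> B) (\<P> - {C, B})" for C' B'
  proof -
    have "union_of_blocks (insert (C \<union> B) (\<P> - {C, B})) C'" using H that(1) by (simp add: hierarchy_def)
    then show ?thesis using that(2) unfolding union_of_blocks_def by (rule bspec)
  qed
  have R: "(\<Sum>C\<in>{C\<in>L. B' \<subseteq> C}. \<eta> (card C)) \<le> rate B'" if "B' \<in> insert (C \<union> B) (\<P> - {C, B})" for B'
    using H that unfolding hierarchy_def by metis
  show nin: "C \<notin> L" 
  proof
    assume "C \<in> L"
    then have "C \<union> B \<subseteq> C \<or> (C \<union> B) \<inter> C = {}" by (intro U) auto
    then show False using BC by auto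
  qed
  have iff: "C \<subseteq> C' \<longleftrightarrow> C \<union> B \<subseteq> C'" "B \<subseteq> C' \<longleftrightarrow> C \<union> B \<subseteq> C'" if "C' \<in> L" for C'
  proof -
    have "C \<union> B \<subseteq> C' \<or> (C \<union> B) \<inter> C' = {}" using that by (intro U) auto
    then show "C \<subseteq> C' \<longleftrightarrow> C \<union> B \<subseteq> C'" "B \<subseteq> C' \<longleftrightarrow> C \<union> B \<subseteq> C'" using BC by auto
  qed
  have "union_of_blocks \<P> C'" if "C' \<in> insert C L" for C'
    unfolding union_of_blocks_def
  proof
    fix B' assume B': "B' \<in> \<P>"
    show "B' \<subseteq> C' \<or> B' \<inter> C' = {}"
    proof (cases "C' = C")
      case True
      then show ?thesis using disj[OF B' C(1)] by auto
    next
      case False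
      then have "C' \<in> L" using that by simp
      then have "C \<union> B \<subseteq> C' \<or> (C \<union> B) \<inter> C' = {}" "B' \<in> \<P> - {C, B} \<Longrightarrow> B' \<subseteq> C' \<or> B' \<inter> C' = {}"
        using U by auto
      then show ?thesis using B' by auto
    qed
  qed
  moreover have "(\<Sum>C\<in>{C'\<in>insert C L. B' \<subseteq> C'}. \<eta> (card C)) \<le> rate B'" if B': "B' \<in> \<P>" for B'
  proof -
    consider "B' = C" | "B' = B" | "B' \<in> \<P> - {C, B}" using B' by blast
    then show ?thesis
    proof cases
      case 1
      have "{C'\<in>insert C L. C \<subseteq> C'} = insert C {C'\<in>L. C \<union> B \<subseteq> C'}" using iff by blast
      then have "(\<Sum>C\<in>{C'\<in>insert C L. B' \<subseteq> C'}. \<eta> (card C)) = \<eta> (card C) + (\<Sum>C\<in>{C'\<in>L. C \<union> B \<subseteq> C'}. \<eta> (card C))"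
        using 1 fL nin by simp
      then show ?thesis using R[of "C \<union> B"] rm(2) 1 by simp
    next
      case 2
      have "{C'\<in>insert C L. B \<subseteq> C'} = {C'\<in>L. C \<union> B \<subseteq> C'}" using iff BC by blast
      then show ?thesis using R[of "C \<union> B"] rm(1) 2 by simp
    next
      case 3
      then have "B' \<inter> C = {}" "B' \<noteq> {}" using disj[OF B' C(1)] partition_on_blocks[OF P B'] by auto
      then have "\<not> B' \<subseteq> C" by auto
      then have "{C'\<in>insert C L. B' \<subseteq> C'} = {C'\<in>L. B' \<subseteq> C'}" by auto
      then show ?thesis using R[of B'] 3 by simp
    qed
  qed
  ultimately show "hierarchy \<P> (insert C L) \<T>"
    using fL L C T unfolding hierarchy_def by simp
qed

text \<open>A nonempty block without source or sink is now larger than \<open>m\<close>, so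
  \<open>card_W\<close> leaves at most one such block. A cut must contain the block \<open>X\<close>
  of the source and can only choose whether to include that large block.\<close>

lemma hierarchy_terminal:
  assumes P: "partition_on W \<P>" and none: "\<And>B. B \<in> \<P> \<Longrightarrow> \<not> active B"
  obtains \<T> where "hierarchy \<P> {} \<T>" "\<And>S. admissible S \<Longrightarrow> union_of_blocks \<P> S \<Longrightarrow> S \<in> \<T>"
proof -
  note disj = partition_on_disjoint_blocks[OF P]
  have UP: "\<Union>\<P> = W" and ne: "\<And>B. B \<in> \<P> \<Longrightarrow> B \<noteq> {}" using P by (auto simp: partition_on_def)
  define \<G> where "\<G> = {B\<in>\<P>. x \<notin> B \<and> B \<subseteq> W - Y}"
  have big: "m < card B" if "B \<in> \<G>" for B
    using none[of B] ne[of B] that unfolding \<G>_def active_def by auto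
  have same: "B1 = B2" if "B1 \<in> \<G>" "B2 \<in> \<G>" for B1 B2
  proof (rule ccontr)
    assume "B1 \<noteq> B2"
    then have "B1 \<inter> B2 = {}" and sub: "B1 \<union> B2 \<subseteq> W" using disj that by (auto simp: \<G>_def)
    then have "card (B1 \<union> B2) = card B1 + card B2"
      by (intro card_Un_disjoint) (auto intro: finite_subset[OF _ finite_W])
    then have "2 * m + 2 \<le> card W" using big[OF that(1)] big[OF that(2)] card_mono[OF finite_W sub] by simp
    then show False using card_W by simp
  qed
  obtain X where X: "X \<in> \<P>" "x \<in> X" using UP source by blast
  define \<T> where "\<T> = {T\<in>{X, X \<union> \<Union>\<G>}. admissible T}"
  have "finite \<T>" "card \<T> \<le> 2"
  proof -
    have sub: "\<T> \<subseteq> {X, X \<union> \<Union>\<G>}" unfolding \<T>_def by blast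
    then show "finite \<T>" by (rule finite_subset) simp
    have "card \<T> \<le> card {X, X \<union> \<Union>\<G>}" using sub by (intro card_mono) auto
    also have "\<dots> \<le> 2" by (simp add: card_insert_if)
    finally show "card \<T> \<le> 2" .
  qed
  then have "hierarchy \<P> {} \<T>"
    using rate_nonneg unfolding hierarchy_def by (simp add: \<T>_def)
  moreover have "S \<in> \<T>" if S: "admissible S" "union_of_blocks \<P> S" for S
  proof -
    have XS: "X \<subseteq> S" using S X unfolding admissible_def union_of_blocks_def by blast
    have cov: "\<exists>B\<in>\<P>. w \<in> B \<and> B \<subseteq> S" if "w \<in> S" for w
      using S that UP unfolding admissible_def union_of_blocks_def by blast
    have "w \<in> X \<union> \<Union>\<G>" if w: "w \<in> S" for w
    proof -
      obtain B where B: "B \<in> \<P>" "w \<in> B" "B \<subseteq> S" using cov[OF w] by blast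
      show ?thesis
      proof (cases "B = X")
        case False
        then have "x \<notin> B" using disj[OF B(1) X(1)] X by blast
        then have "B \<in> \<G>" using B S unfolding \<G>_def admissible_def by blast
        then show ?thesis using B by blast
      qed (use B in blast)
    qed
    then have sub: "S \<subseteq> X \<union> \<Union>\<G>" by blast
    show ?thesis
    proof (cases "S = X")
      case False
      then obtain w where w: "w \<in> S" "w \<notin> X" using XS by blast
      then obtain B where B: "B \<in> \<P>" "w \<in> B" "B \<subseteq> S" using cov by blast
      obtain G where G: "G \<in> \<G>" "w \<in> G" using sub w by blast
      have "G = B" using disj[of G B] G B unfolding \<G>_def by blast
      moreover have "\<Union>\<G> = G" using same G by blast
      ultimately have "S = X \<union> \<Union>\<G>" using sub XS B by blast
      then show ?thesis using S unfolding \<T>_def by simp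
    qed (use S in \<open>simp add: \<T>_def\<close>)
  qed
  ultimately show thesis by (rule that)
qed

text \<open>
  The random contraction is derandomised: the weights \<open>v\<close> play the role of the law of the cut, and
  the merging edge is chosen in \<open>hierarchy_step_exists\<close> so that the average does not decrease.
\<close>

lemma hierarchy_exists:
  fixes s :: "'i \<Rightarrow> 'a set"
  assumes "partition_on W \<P>" "finite I" "\<And>i. i \<in> I \<Longrightarrow> 0 \<le> v i"
    "\<And>i. i \<in> I \<Longrightarrow> admissible (s i)" "\<And>i. i \<in> I \<Longrightarrow> union_of_blocks \<P> (s i)"
  shows "\<exists>L \<T>. hierarchy \<P> L \<T> \<and>
    (\<Sum>i\<in>I. v i * exp (- cost \<P> (s i))) \<le> (\<Sum>i\<in>{i\<in>I. represented L \<T> (s i)}. v i)"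
  using assms
proof (induction "card \<P>" arbitrary: \<P> I s rule: less_induct)
  case less
  note P = less.prems(1) and fI = less.prems(2) and v = less.prems(3)
    and adm = less.prems(4) and ub = less.prems(5)
  have fP: "finite \<P>" using finite_elements[OF finite_W P] .
  note disj = partition_on_disjoint_blocks[OF P]
  show ?case
  proof (cases "\<exists>B\<in>\<P>. active B")
    case False
    then obtain \<T> where T: "hierarchy \<P> {} \<T>" "\<And>S. admissible S \<Longrightarrow> union_of_blocks \<P> S \<Longrightarrow> S \<in> \<T>"
      using hierarchy_terminal[OF P] by blast
    have "{i\<in>I. represented {} \<T> (s i)} = I"
      using T(2) adm ub unfolding represented_def by auto
    moreover have "cost \<P> S = 0" for S
      unfolding cost_def using False by (intro sum.neutral) (auto simp: rate_def)
    ultimately show ?thesis using T(1) by (intro exI[of _ "{}"] exI[of _ \<T>]) simp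
  next
    case True
    obtain C where C: "C \<in> \<P>" "active C" and min: "\<And>B. B \<in> \<P> \<Longrightarrow> active B \<Longrightarrow> card C \<le> card B"
    proof -
      have "finite {B\<in>\<P>. active B}" "{B\<in>\<P>. active B} \<noteq> {}" using True fP by auto
      then show thesis
        using that arg_min_if_finite(1)[of "{B\<in>\<P>. active B}" card] arg_min_least[of "{B\<in>\<P>. active B}" _ card]
        by blast
    qed
    \<comment> \<open>Flip exactly those cuts that meet the boundary of \<open>C\<close> too
      heavily; afterwards every cut is light at \<open>C\<close>, and neither its cost nor its
      admissibility is spoilt.\<close>
    define \<sigma> where "\<sigma> S = (if 3 / 4 * wt (bd C) < wt (bd C \<inter> bd S) then sym_diff S C else S)" for S
    have split: "wt (bd C) = wt (bd C \<inter> bd S) + wt (bd C - bd S)" for S by (rule sum.Int_Diff) simp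
    have Lpos: "0 < wt (bd C)" using active_wt_pos[OF C(2)] by simp
    have Cact: "C \<subseteq> W - Y" "x \<notin> C" using C by (auto simp: active_def)
    have light: "wt (bd C \<inter> bd (\<sigma> S)) \<le> 3 / 4 * wt (bd C)" for S
    proof (cases "3 / 4 * wt (bd C) < wt (bd C \<inter> bd S)")
      case True
      have "bd C \<inter> bd (sym_diff S C) = bd C - bd S" by (auto simp: bd_sym_diff)
      then show ?thesis using True split[of S] Lpos by (simp add: \<sigma>_def)
    qed (simp add: \<sigma>_def)
    have cost_le: "cost \<P> (\<sigma> S) \<le> cost \<P> S" for S
      using cost_flip[OF P C min] by (simp add: \<sigma>_def)
    have adm\<sigma>: "admissible (\<sigma> S)" if "admissible S" for S
      using that Cact unfolding admissible_def \<sigma>_def by auto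
    have ub\<sigma>: "union_of_blocks \<P> (\<sigma> S)" if "union_of_blocks \<P> S" for S
      unfolding union_of_blocks_def
    proof
      fix B assume B: "B \<in> \<P>"
      have "B \<subseteq> S \<or> B \<inter> S = {}" using that B unfolding union_of_blocks_def by blast
      moreover have "B = C \<or> B \<inter> C = {}" using disj[OF B C(1)] by blast
      ultimately show "B \<subseteq> \<sigma> S \<or> B \<inter> \<sigma> S = {}" unfolding \<sigma>_def by auto
    qed
    obtain B where B: "B \<in> \<P>" "B \<noteq> C" and step:
      "(\<Sum>i\<in>I. v i * exp (- cost \<P> (\<sigma> (s i)))) \<le>
        (\<Sum>i\<in>{i\<in>I. \<exists>e\<in>bd C - bd (\<sigma> (s i)). \<exists>u w. e = {u, w} \<and> u \<in> C \<and> w \<in> B}.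
           v i * exp (- cost (insert (C \<union> B) (\<P> - {C, B})) (\<sigma> (s i))))"
    proof (rule hierarchy_step_exists[OF P C, where s = "\<lambda>i. \<sigma> (s i)" and v = v and I = I])
      show "\<And>B. B \<in> \<P> \<Longrightarrow> active B \<Longrightarrow> card C \<le> card B" by (rule min)
      show "\<And>i. i \<in> I \<Longrightarrow> 0 \<le> v i" by (rule v)
      show "\<And>i. i \<in> I \<Longrightarrow> wt (bd C \<inter> bd (\<sigma> (s i))) \<le> 3 / 4 * wt (bd C)" by (rule light)
    qed (use fI that in auto)
    define J where "J = {i\<in>I. \<exists>e\<in>bd C - bd (\<sigma> (s i)). \<exists>u w. e = {u, w} \<and> u \<in> C \<and> w \<in> B}"
    define \<P>' where "\<P>' = insert (C \<union> B) (\<P> - {C, B})"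
    have J: "J \<subseteq> I" unfolding J_def by blast
    have "card \<P>' < card \<P>"
    proof -
      have "card \<P>' \<le> Suc (card (\<P> - {C, B}))" unfolding \<P>'_def by (rule card_insert_le_m1) auto
      also have "card (\<P> - {C, B}) = card \<P> - 2" using fP B C by (simp add: card_Diff_subset)
      also have "Suc (card \<P> - 2) < card \<P>"
      proof -
        have "card {C, B} \<le> card \<P>" using fP B C by (intro card_mono) auto
        then show ?thesis using B by simp
      qed
      finally show ?thesis .
    qed
    moreover have "partition_on W \<P>'" unfolding \<P>'_def using partition_on_merge[OF P C(1) B(1)] .
    \<comment> \<open>For \<open>i\<close> in \<open>J\<close> some edge joins \<open>C\<close> to
      \<open>B\<close> without being cut, so both blocks lie on the same side of
      \<open>\<sigma> (s i)\<close> and the cut survives the merge.\<close>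
    moreover have "union_of_blocks \<P>' (\<sigma> (s i))" if i: "i \<in> J" for i
      unfolding union_of_blocks_def
    proof
      fix B' assume B': "B' \<in> \<P>'"
      have ubi: "\<And>B. B \<in> \<P> \<Longrightarrow> B \<subseteq> \<sigma> (s i) \<or> B \<inter> \<sigma> (s i) = {}"
        using ub\<sigma>[OF ub] i J unfolding union_of_blocks_def by blast
      obtain u w where uw: "{u, w} \<in> bd C" "{u, w} \<notin> bd (\<sigma> (s i))" "u \<in> C" "w \<in> B"
        using i unfolding J_def by blast
      then have "u \<in> \<sigma> (s i) \<longleftrightarrow> w \<in> \<sigma> (s i)" by (simp add: doubleton_in_cut_edges_iff)
      then have "C \<union> B \<subseteq> \<sigma> (s i) \<or> (C \<union> B) \<inter> \<sigma> (s i) = {}"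
        using ubi[OF C(1)] ubi[OF B(1)] uw(3,4) by blast
      then show "B' \<subseteq> \<sigma> (s i) \<or> B' \<inter> \<sigma> (s i) = {}" using B' ubi unfolding \<P>'_def by blast
    qed
    moreover have "\<And>i. i \<in> J \<Longrightarrow> admissible (\<sigma> (s i))" "\<And>i. i \<in> J \<Longrightarrow> 0 \<le> v i"
      using adm adm\<sigma> v J by auto
    ultimately have "\<exists>L \<T>. hierarchy \<P>' L \<T> \<and>
      (\<Sum>i\<in>J. v i * exp (- cost \<P>' (\<sigma> (s i)))) \<le> (\<Sum>i\<in>{i\<in>J. represented L \<T> (\<sigma> (s i))}. v i)"
      using finite_subset[OF J fI] by (intro less.hyps)
    then obtain L \<T> where H: "hierarchy \<P>' L \<T>" and le:
      "(\<Sum>i\<in>J. v i * exp (- cost \<P>' (\<sigma> (s i)))) \<le> (\<Sum>i\<in>{i\<in>J. represented L \<T> (\<sigma> (s i))}. v i)"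
      by blast
    note Hm = hierarchy_merge[OF P C min B H[unfolded \<P>'_def]]
    have fL: "finite L" using H unfolding hierarchy_def by blast
    \<comment> \<open>Undo the flip: a representation of \<open>\<sigma> S\<close> becomes one of
      \<open>S\<close> by adding \<open>C\<close> to \<open>F\<close> when \<open>S\<close> was
      flipped. This uses that \<open>C\<close> is not yet in \<open>L\<close>.\<close>
    have rep: "represented (insert C L) \<T> S" if rS: "represented L \<T> (\<sigma> S)" for S
    proof -
      obtain T F where TF: "T \<in> \<T>" "F \<subseteq> L" "\<sigma> S = flip T F"
        "wt (bd T) + (\<Sum>C\<in>F. wt (bd C)) / 2 \<le> wt (bd (\<sigma> S))"
        using rS unfolding represented_def by blast
      show ?thesis
      proof (cases "3 / 4 * wt (bd C) < wt (bd C \<inter> bd S)")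
        case False
        then have "\<sigma> S = S" by (simp add: \<sigma>_def)
        then show ?thesis using TF unfolding represented_def by auto
      next
        case True
        then have \<sigma>: "\<sigma> S = sym_diff S C" by (simp add: \<sigma>_def)
        have F: "finite F" "C \<notin> F" using TF(2) fL Hm(2) finite_subset by auto
        have "S = flip T (insert C F)"
          unfolding flip_insert[OF F] TF(3)[symmetric] \<sigma> by auto
        moreover have "wt (bd (\<sigma> S)) + wt (bd C) / 2 \<le> wt (bd S)"
        proof -
          have "wt (bd (\<sigma> S)) = wt (bd S - bd C) + wt (bd C - bd S)"
            unfolding \<sigma> bd_sym_diff by (rule sum.union_disjoint) auto
          moreover have "wt (bd S) = wt (bd C \<inter> bd S) + wt (bd S - bd C)"
            by (subst Int_commute, rule sum.Int_Diff) simp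
          ultimately show ?thesis using True split[of S] by linarith
        qed
        moreover have "(\<Sum>C\<in>insert C F. wt (bd C)) = wt (bd C) + (\<Sum>C\<in>F. wt (bd C))" using F by simp
        ultimately have "insert C F \<subseteq> insert C L \<and> S = flip T (insert C F) \<and>
            wt (bd T) + (\<Sum>C\<in>insert C F. wt (bd C)) / 2 \<le> wt (bd S)"
          using TF(2,4) by (intro conjI) (blast, assumption, argo)
        then show ?thesis using TF(1) unfolding represented_def by blast
      qed
    qed
    have "(\<Sum>i\<in>I. v i * exp (- cost \<P> (s i))) \<le> (\<Sum>i\<in>I. v i * exp (- cost \<P> (\<sigma> (s i))))"
      using v cost_le by (intro sum_mono mult_left_mono) auto
    also have "\<dots> \<le> (\<Sum>i\<in>J. v i * exp (- cost \<P>' (\<sigma> (s i))))"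
      using step unfolding J_def \<P>'_def .
    also have "\<dots> \<le> (\<Sum>i\<in>{i\<in>J. represented L \<T> (\<sigma> (s i))}. v i)" by (rule le)
    also have "\<dots> \<le> (\<Sum>i\<in>{i\<in>I. represented (insert C L) \<T> (s i)}. v i)"
      using rep J fI v by (intro sum_mono2) auto
    finally show ?thesis using Hm(1) by blast
  qed
qed

section \<open>Probability of a closed cut in a finite network\<close>

lemma partition_on_singletons_W: "partition_on W ((\<lambda>w. {w}) ` W)"
  by (auto simp: partition_on_def disjoint_def)

lemma rate_singleton_le: "rate {w} \<le> \<tau> 1"
  by (simp add: rate_def tau_nonneg)

lemma cost_singletons_le: "cost ((\<lambda>w. {w}) ` W) S \<le> 4 * \<tau> 1 * wt (bd S)"
proof -
  have "cost ((\<lambda>w. {w}) ` W) S \<le> (\<Sum>B\<in>(\<lambda>w. {w}) ` W. 2 * \<tau> 1 * wt (bd B \<inter> bd S))"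
    unfolding cost_def using rate_singleton_le bd_subset
    by (intro sum_mono mult_right_mono) (auto intro!: wt_nonneg)
  also have "\<dots> = 2 * \<tau> 1 * (\<Sum>B\<in>(\<lambda>w. {w}) ` W. wt (bd B \<inter> bd S))"
    by (simp add: sum_distrib_left)
  also have "\<dots> \<le> 2 * \<tau> 1 * (2 * wt (bd S))"
    using tau_nonneg by (intro mult_left_mono sum_wt_blocks_le partition_on_singletons_W bd_subset) auto
  finally show ?thesis by simp
qed

text \<open>The product hypothesis of \<open>expected_attached_weight_le\<close> with
  \<open>\<kappa> = 7 * \<tau> 1\<close>. As \<open>\<tau> 1 \<le> 1 / 625\<close>, the combined
  exponent \<open>1/2 - 9 * \<tau> 1\<close> is at least 1/3, and
  \<open>exp (- w / 3) \<le> 3 / w\<close> bounds each term by \<open>3 * \<eta> (card C)\<close>. A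
  member cutting \<open>e\<close> contains an endpoint of \<open>e\<close>, and each endpoint
  contributes at most \<open>3 * \<tau> 1\<close>; finally
  \<open>exp (6 * \<tau> 1) \<le> 1 + 7 * \<tau> 1\<close>.\<close>

lemma hierarchy_prod_le:
  assumes H: "hierarchy ((\<lambda>w. {w}) ` W) L \<T>" and e: "e \<in> E" and b: "\<tau> 1 \<le> 1 / 625"
  shows "(\<Prod>C\<in>{C\<in>L. e \<in> bd C}. 1 + exp (- ((1 - 4 * \<tau> 1) / 2 * wt (bd C))) * exp (7 * \<tau> 1 * wt (bd C)))
     \<le> 1 + 7 * \<tau> 1"
proof -
  obtain u v where uv: "e = {u, v}" "u \<in> W" "v \<in> W" using edge[OF e] by blast
  have fL: "finite L" and act: "\<And>C. C \<in> L \<Longrightarrow> active C" using H by (simp_all add: hierarchy_def)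
  let ?a = "\<lambda>C. exp (- ((1 - 4 * \<tau> 1) / 2 * wt (bd C))) * exp (7 * \<tau> 1 * wt (bd C))"
  have a: "?a C \<le> 3 * \<eta> (card C)" if "C \<in> L" for C
  proof -
    have w: "0 < wt (bd C)" "1 \<le> \<eta> (card C) * wt (bd C)" using active_wt_pos[OF act[OF that]] by auto
    have "?a C = exp (- ((1 / 2 - 9 * \<tau> 1) * wt (bd C)))"
      unfolding exp_add[symmetric] by (rule arg_cong[where f = exp]) (simp add: field_simps)
    also have "\<dots> \<le> exp (- (wt (bd C) / 3))"
    proof -
      have "1 / 3 * wt (bd C) \<le> (1 / 2 - 9 * \<tau> 1) * wt (bd C)" using w b by (intro mult_right_mono) auto
      then show ?thesis by simp
    qed
    also have "\<dots> = 1 / exp (wt (bd C) / 3)" by (simp add: exp_minus inverse_eq_divide)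
    also have "\<dots> \<le> 1 / (wt (bd C) / 3)"
    proof (rule divide_left_mono)
      show "wt (bd C) / 3 \<le> exp (wt (bd C) / 3)" using exp_ge_add_one_self[of "wt (bd C) / 3"] by linarith
    qed (use w in auto)
    also have "\<dots> \<le> 3 * \<eta> (card C)" using w by (simp add: field_simps)
    finally show ?thesis .
  qed
  have vert: "(\<Sum>C\<in>{C\<in>L. w \<in> C}. \<eta> (card C)) \<le> \<tau> 1" if "w \<in> W" for w
  proof -
    have "(\<Sum>C\<in>{C\<in>L. {w} \<subseteq> C}. \<eta> (card C)) \<le> rate {w}" using H that unfolding hierarchy_def by blast
    then show ?thesis using rate_singleton_le[of w] by simp
  qed
  have "(\<Prod>C\<in>{C\<in>L. e \<in> bd C}. 1 + ?a C) \<le> (\<Prod>C\<in>{C\<in>L. e \<in> bd C}. exp (?a C))"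
    by (intro prod_mono conjI exp_ge_add_one_self) (auto intro: add_nonneg_nonneg)
  also have "\<dots> = exp (\<Sum>C\<in>{C\<in>L. e \<in> bd C}. ?a C)"
    using fL by (simp add: exp_sum)
  also have "\<dots> \<le> exp (6 * \<tau> 1)"
  proof -
    have "(\<Sum>C\<in>{C\<in>L. e \<in> bd C}. ?a C) \<le> (\<Sum>C\<in>{C\<in>L. e \<in> bd C}. 3 * \<eta> (card C))"
      using a by (intro sum_mono) auto
    also have "\<dots> \<le> (\<Sum>C\<in>{C\<in>L. u \<in> C} \<union> {C\<in>L. v \<in> C}. 3 * \<eta> (card C))"
      using fL eta_nonneg by (intro sum_mono2) (auto simp: uv(1) doubleton_in_cut_edges_iff)
    also have "\<dots> \<le> (\<Sum>C\<in>{C\<in>L. u \<in> C}. 3 * \<eta> (card C)) + (\<Sum>C\<in>{C\<in>L. v \<in> C}. 3 * \<eta> (card C))"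
      using fL eta_nonneg by (subst sum_Un) (auto intro!: sum_nonneg)
    also have "\<dots> \<le> 3 * \<tau> 1 + 3 * \<tau> 1"
      unfolding sum_distrib_left[symmetric] using vert uv by (intro add_mono mult_left_mono) auto
    finally show ?thesis by simp
  qed
  also have "\<dots> \<le> 1 + 6 * \<tau> 1 + (6 * \<tau> 1)\<^sup>2"
    using tau_nonneg[of 1] b by (intro exp_bound) auto
  also have "\<dots> \<le> 1 + 7 * \<tau> 1"
  proof -
    have "36 * \<tau> 1 * \<tau> 1 \<le> 1 * \<tau> 1" using tau_nonneg[of 1] b by (intro mult_right_mono) auto
    then show ?thesis by (simp add: power2_eq_square)
  qed
  finally show ?thesis .
qed

text \<open>An open edge in the boundary of a dropped block lies in neither \<open>bd T\<close> nor
  the boundary of a kept block, so it is not cut by \<open>flip T F'\<close>. For any other open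
  edge, dropping blocks leaves the parity unchanged.\<close>

lemma closed_after_detaching:
  assumes F: "finite F" "F' \<subseteq> F" and closed: "bd (flip T F) \<inter> Q = {}"
    and det: "\<forall>C\<in>F - F'. \<forall>e\<in>bd C \<inter> Q. e \<notin> bd T \<and> (\<forall>C'\<in>F'. e \<notin> bd C')"
  shows "bd (flip T F') \<inter> Q = {}"
proof (rule ccontr)
  assume "bd (flip T F') \<inter> Q \<noteq> {}"
  then obtain e where e: "e \<in> bd (flip T F')" "e \<in> Q" by auto
  have F': "finite F'" using F finite_subset by auto
  show False
  proof (cases "\<exists>C\<in>F - F'. e \<in> bd C")
    case True
    then have eT: "e \<notin> bd T" and none: "{C\<in>F'. e \<in> bd C} = {}" using det e(2) by auto
    have "odd (card {C\<in>F'. e \<in> bd C})" using e(1) eT bd_flip[OF F'] by simp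
    then show False unfolding none by simp
  next
    case False
    then have "{C\<in>F'. e \<in> bd C} = {C\<in>F. e \<in> bd C}" using F(2) by auto
    then have "e \<in> bd (flip T F)" using e(1) bd_flip[OF F'] bd_flip[OF F(1)] by simp
    then show False using closed e(2) by auto
  qed
qed

lemma admissible_flip:
  assumes "admissible T" "\<And>C. C \<in> F \<Longrightarrow> active C"
  shows "admissible (flip T F)"
proof -
  have "w \<in> flip T F \<longleftrightarrow> w \<in> T" if "w = x \<or> w \<notin> W - Y" for w
  proof -
    have none: "{C\<in>F. w \<in> C} = {}" using assms(2) that unfolding active_def by auto
    show ?thesis unfolding flip_def mem_Collect_eq none by simp
  qed
  then show ?thesis using assms(1) unfolding admissible_def by blast
qed

text \<open>The exponent collects two losses: \<open>4 * \<tau> 1\<close> from the contraction cost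
  and \<open>7 * \<tau> 1\<close> from the sum over attached families. The factor 2 counts the
  terminal cuts.\<close>

lemma closed_cut_prob_le:
  assumes b: "\<tau> 1 \<le> 1 / 625" and chi: "\<And>S. admissible S \<Longrightarrow> \<rho> \<le> wt (bd S)"
  shows "perc_sum l E (\<lambda>Q. of_bool (\<exists>S. admissible S \<and> bd S \<inter> Q = {}))
    \<le> 2 * exp (- ((1 - 11 * \<tau> 1) * \<rho>))"
proof -
  define \<beta> where "\<beta> = \<tau> 1"
  have \<beta>: "0 \<le> \<beta>" "\<beta> \<le> 1 / 625" using b tau_nonneg by (auto simp: \<beta>_def)
  define A where "A Q = {S. admissible S \<and> bd S \<inter> Q = {}}" for Q
  define s where "s Q = arg_min_on (\<lambda>S. wt (bd S)) (A Q)" for Q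
  have finA: "finite (A Q)" for Q
    by (rule finite_subset[of _ "Pow W"]) (auto simp: A_def admissible_def finite_W)
  have sA: "s Q \<in> A Q" if "A Q \<noteq> {}" for Q
    unfolding s_def using arg_min_if_finite(1)[OF finA that] .
  have smin: "wt (bd (s Q)) \<le> wt (bd S)" if "S \<in> A Q" for Q S
    unfolding s_def using that by (intro arg_min_least finA) auto
  define I where "I = {Q\<in>Pow E. A Q \<noteq> {}}"
  define pr where "pr Q = (\<Prod>e\<in>Q. 1 - exp (- l e)) * (\<Prod>e\<in>E - Q. exp (- l e))" for Q
  have pr: "0 \<le> pr Q" if "Q \<subseteq> E" for Q
    unfolding pr_def using l_nonneg that by (intro mult_nonneg_nonneg prod_nonneg) auto
  \<comment> \<open>The exponential compensates the cost of \<open>s Q\<close> at the singleton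
    partition, see \<open>cost_singletons_le\<close>.\<close>
  define v where "v Q = pr Q * exp (4 * \<beta> * wt (bd (s Q)))" for Q
  let ?P = "(\<lambda>w. {w}) ` W"
  have finI: "finite I" using finite_E by (simp add: I_def)
  have "\<exists>L \<T>. hierarchy ?P L \<T> \<and>
    (\<Sum>Q\<in>I. v Q * exp (- cost ?P (s Q))) \<le> (\<Sum>Q\<in>{Q\<in>I. represented L \<T> (s Q)}. v Q)"
  proof (rule hierarchy_exists[OF partition_on_singletons_W finI])
    show "\<And>Q. Q \<in> I \<Longrightarrow> 0 \<le> v Q" using pr by (auto simp: v_def I_def)
    show "\<And>Q. Q \<in> I \<Longrightarrow> admissible (s Q)" using sA by (auto simp: I_def A_def)
    show "\<And>Q. Q \<in> I \<Longrightarrow> union_of_blocks ?P (s Q)" by (auto simp: union_of_blocks_def)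
  qed
  then obtain L \<T> where H: "hierarchy ?P L \<T>"
    and le: "(\<Sum>Q\<in>I. v Q * exp (- cost ?P (s Q))) \<le> (\<Sum>Q\<in>{Q\<in>I. represented L \<T> (s Q)}. v Q)"
    by blast
  have fL: "finite L" and act: "\<And>C. C \<in> L \<Longrightarrow> active C"
    and T: "finite \<T>" "card \<T> \<le> 2" "\<And>T. T \<in> \<T> \<Longrightarrow> admissible T"
    using H by (simp_all add: hierarchy_def)
  define g where "g C = exp (- ((1 - 4 * \<beta>) / 2 * wt (bd C)))" for C
  define heavy where "heavy T F \<longleftrightarrow> wt (bd T) + (\<Sum>C\<in>F. wt (bd C)) / 2 \<le> wt (bd (flip T F))" for T F
  \<comment> \<open>\<open>X T F\<close> is the contribution of the candidate
    \<open>flip T F\<close>, restricted to its being closed, to \<open>F\<close> being attached to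
    \<open>bd T\<close>, and to the weight inequality \<open>heavy\<close>.\<close>
  define X where "X T F = (\<lambda>Q. of_bool (heavy T F) * exp (4 * \<beta> * wt (bd (flip T F))) *
      (of_bool (Q \<inter> bd (flip T F) = {}) * of_bool (attached bd Q (bd T) F)))" for T F
  have X0: "0 \<le> X T F Q" for T F Q by (simp add: X_def)
  \<comment> \<open>Keep only the attached part \<open>F'\<close> of the family representing
    \<open>s Q\<close>. The cut \<open>flip T0 F'\<close> is still closed, so minimality of
    \<open>s Q\<close> gives it at least the weight of \<open>s Q\<close>; as \<open>F'\<close> is
    smaller than \<open>F\<close>, the inequality \<open>heavy\<close> persists.\<close>
  have key: "exp (4 * \<beta> * wt (bd (s Q))) \<le> (\<Sum>T\<in>\<T>. \<Sum>F\<in>Pow L. X T F Q)"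
    if Q: "Q \<in> I" "represented L \<T> (s Q)" for Q
  proof -
    obtain T0 F where TF: "T0 \<in> \<T>" "F \<subseteq> L" "s Q = flip T0 F"
      "wt (bd T0) + (\<Sum>C\<in>F. wt (bd C)) / 2 \<le> wt (bd (s Q))"
      using Q(2) unfolding represented_def by blast
    have fF: "finite F" using TF(2) fL by (rule finite_subset)
    obtain F' where F': "F' \<subseteq> F" "attached bd Q (bd T0) F'"
      "\<forall>C\<in>F - F'. \<forall>e\<in>bd C \<inter> Q. e \<notin> bd T0 \<and> (\<forall>C'\<in>F'. e \<notin> bd C')"
      by (rule attached_part_exists[OF fF])
    have "bd (flip T0 F) \<inter> Q = {}" using sA[of Q] Q(1) TF(3) by (auto simp: I_def A_def)
    from closed_after_detaching[OF fF F'(1) this F'(3)]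
    have cl: "bd (flip T0 F') \<inter> Q = {}" .
    have "admissible (flip T0 F')" using T(3)[OF TF(1)] act TF(2) F'(1) by (intro admissible_flip) auto
    then have m: "wt (bd (s Q)) \<le> wt (bd (flip T0 F'))" using cl by (intro smin) (simp add: A_def)
    have "(\<Sum>C\<in>F'. wt (bd C)) \<le> (\<Sum>C\<in>F. wt (bd C))"
      using fF F'(1) bd_subset by (intro sum_mono2) (auto intro!: wt_nonneg)
    then have "heavy T0 F'" unfolding heavy_def using TF(4) m by linarith
    then have "X T0 F' Q = exp (4 * \<beta> * wt (bd (flip T0 F')))"
      using cl F'(2) by (simp add: X_def Int_commute)
    moreover have "exp (4 * \<beta> * wt (bd (s Q))) \<le> exp (4 * \<beta> * wt (bd (flip T0 F')))"
      using m \<beta> by (simp add: mult_left_mono)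
    moreover have "X T0 F' Q \<le> (\<Sum>F\<in>Pow L. X T0 F Q)"
      using TF(2) F'(1) fL X0 by (intro member_le_sum) auto
    moreover have "(\<Sum>F\<in>Pow L. X T0 F Q) \<le> (\<Sum>T\<in>\<T>. \<Sum>F\<in>Pow L. X T F Q)"
      using TF(1) T(1) X0 by (intro member_le_sum) (auto intro!: sum_nonneg)
    ultimately show ?thesis by linarith
  qed
  \<comment> \<open>Being attached is increasing in the open set, so closedness of the cut gives a
    factor \<open>exp (- w)\<close>, with \<open>w\<close> its weight. Then \<open>heavy\<close>
    distributes the exponent \<open>(1 - 4 * \<beta>) * w\<close> over \<open>T\<close> and the
    flipped blocks.\<close>
  have bound: "perc_sum l E (X T F) \<le>
      exp (- ((1 - 4 * \<beta>) * wt (bd T))) * ((\<Prod>C\<in>F. g C) * perc_sum l E (\<lambda>Q. of_bool (attached bd Q (bd T) F)))"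
    if "F \<subseteq> L" for T F
  proof (cases "heavy T F")
    case False
    then show ?thesis using finite_E l_nonneg
      by (auto simp: X_def perc_sum_const g_def intro!: mult_nonneg_nonneg perc_sum_nonneg prod_nonneg)
  next
    case True
    have fF: "finite F" using that fL by (rule finite_subset)
    let ?w = "wt (bd (flip T F))"
    let ?a = "perc_sum l E (\<lambda>Q. of_bool (attached bd Q (bd T) F)) :: real"
    have a: "0 \<le> ?a" using finite_E l_nonneg by (intro perc_sum_nonneg) auto
    have "perc_sum l E (X T F) = exp (4 * \<beta> * ?w) *
        perc_sum l E (\<lambda>Q. of_bool (Q \<inter> bd (flip T F) = {}) * of_bool (attached bd Q (bd T) F))"
      unfolding X_def perc_sum_cmult using True by simp
    also have "\<dots> \<le> exp (4 * \<beta> * ?w) * (exp (- ?w) * ?a)"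
    proof (intro mult_left_mono perc_sum_closed_le[OF finite_E l_nonneg bd_subset])
      show "mono (\<lambda>Q. of_bool (attached bd Q (bd T) F) :: real)"
        by (intro monoI) (auto dest: attached_mono)
    qed auto
    also have "\<dots> = exp (- ((1 - 4 * \<beta>) * ?w)) * ?a"
    proof -
      have "4 * \<beta> * ?w + - ?w = - ((1 - 4 * \<beta>) * ?w)" by (simp add: algebra_simps)
      then show ?thesis unfolding mult.assoc[symmetric] mult_exp_exp by simp
    qed
    also have "\<dots> \<le> exp (- ((1 - 4 * \<beta>) * (wt (bd T) + (\<Sum>C\<in>F. wt (bd C)) / 2))) * ?a"
    proof (intro mult_right_mono a)
      have "(1 - 4 * \<beta>) * (wt (bd T) + (\<Sum>C\<in>F. wt (bd C)) / 2) \<le> (1 - 4 * \<beta>) * ?w"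
        using True \<beta> by (intro mult_left_mono) (auto simp: heavy_def)
      then show "exp (- ((1 - 4 * \<beta>) * ?w)) \<le> exp (- ((1 - 4 * \<beta>) * (wt (bd T) + (\<Sum>C\<in>F. wt (bd C)) / 2)))"
        by simp
    qed
    also have "exp (- ((1 - 4 * \<beta>) * (wt (bd T) + (\<Sum>C\<in>F. wt (bd C)) / 2)))
        = exp (- ((1 - 4 * \<beta>) * wt (bd T))) * (\<Prod>C\<in>F. g C)"
    proof -
      have "(\<Prod>C\<in>F. g C) = exp (\<Sum>C\<in>F. - ((1 - 4 * \<beta>) / 2 * wt (bd C)))"
        unfolding g_def using fF by (simp add: exp_sum)
      also have "(\<Sum>C\<in>F. - ((1 - 4 * \<beta>) / 2 * wt (bd C))) = - ((1 - 4 * \<beta>) / 2 * (\<Sum>C\<in>F. wt (bd C)))"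
        unfolding sum_negf sum_distrib_left ..
      finally show ?thesis unfolding mult_exp_exp by (auto simp: mult_exp_exp field_simps)
    qed
    finally show ?thesis by (simp add: mult.assoc)
  qed
  have "perc_sum l E (\<lambda>Q. of_bool (\<exists>S. admissible S \<and> bd S \<inter> Q = {})) = (\<Sum>Q\<in>Pow E. if A Q \<noteq> {} then pr Q else 0)"
    unfolding perc_sum_def by (intro sum.cong) (auto simp: A_def pr_def)
  also have "\<dots> = (\<Sum>Q\<in>I. pr Q)"
    unfolding I_def using finite_E by (subst sum.inter_filter) auto
  also have "\<dots> \<le> (\<Sum>Q\<in>I. v Q * exp (- cost ?P (s Q)))"
  proof (rule sum_mono)
    fix Q assume "Q \<in> I"
    then have p: "0 \<le> pr Q" using pr by (auto simp: I_def)
    have "1 \<le> exp (4 * \<beta> * wt (bd (s Q)) + - cost ?P (s Q))"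
      using cost_singletons_le[of "s Q"] by (simp add: \<beta>_def)
    then have "pr Q * 1 \<le> pr Q * exp (4 * \<beta> * wt (bd (s Q)) + - cost ?P (s Q))"
      using p by (intro mult_left_mono)
    then show "pr Q \<le> v Q * exp (- cost ?P (s Q))" unfolding v_def exp_add by (simp add: mult.assoc)
  qed
  also have "\<dots> \<le> (\<Sum>Q\<in>{Q\<in>I. represented L \<T> (s Q)}. v Q)" by (rule le)
  also have "\<dots> \<le> (\<Sum>Q\<in>{Q\<in>I. represented L \<T> (s Q)}. pr Q * (\<Sum>T\<in>\<T>. \<Sum>F\<in>Pow L. X T F Q))"
    unfolding v_def using key pr by (intro sum_mono mult_left_mono) (auto simp: I_def)
  also have "\<dots> \<le> (\<Sum>Q\<in>Pow E. pr Q * (\<Sum>T\<in>\<T>. \<Sum>F\<in>Pow L. X T F Q))"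
    using finite_E pr X0 by (intro sum_mono2) (auto simp: I_def intro!: mult_nonneg_nonneg sum_nonneg)
  also have "\<dots> = (\<Sum>T\<in>\<T>. \<Sum>F\<in>Pow L. perc_sum l E (X T F))"
    unfolding perc_sum_sum[symmetric] by (simp add: perc_sum_def pr_def)
  also have "\<dots> \<le> (\<Sum>T\<in>\<T>. \<Sum>F\<in>Pow L.
      exp (- ((1 - 4 * \<beta>) * wt (bd T))) * ((\<Prod>C\<in>F. g C) * perc_sum l E (\<lambda>Q. of_bool (attached bd Q (bd T) F))))"
    using bound by (intro sum_mono) auto
  also have "\<dots> = (\<Sum>T\<in>\<T>. exp (- ((1 - 4 * \<beta>) * wt (bd T))) * perc_sum l E (attached_weight bd g L (bd T)))"
  proof (rule sum.cong[OF refl])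
    fix T
    have "perc_sum l E (attached_weight bd g L (bd T))
        = (\<Sum>F\<in>Pow L. (\<Prod>C\<in>F. g C) * perc_sum l E (\<lambda>Q. of_bool (attached bd Q (bd T) F)))"
      unfolding attached_weight_def perc_sum_sum perc_sum_cmult[symmetric]
      by (intro sum.cong refl) (simp add: mult.commute)
    then show "(\<Sum>F\<in>Pow L. exp (- ((1 - 4 * \<beta>) * wt (bd T))) *
         ((\<Prod>C\<in>F. g C) * perc_sum l E (\<lambda>Q. of_bool (attached bd Q (bd T) F))))
       = exp (- ((1 - 4 * \<beta>) * wt (bd T))) * perc_sum l E (attached_weight bd g L (bd T))"
      by (simp only: sum_distrib_left)
  qed
  also have "\<dots> \<le> (\<Sum>T\<in>\<T>. exp (- ((1 - 11 * \<beta>) * \<rho>)))"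
  proof (rule sum_mono)
    fix T assume TT: "T \<in> \<T>"
    have "perc_sum l E (attached_weight bd g L (bd T)) \<le> exp (7 * \<beta> * wt (bd T \<inter> E))"
    proof (rule expected_attached_weight_le[OF finite_E fL l_nonneg])
      show "sum l (bd C \<inter> E) \<le> wt (bd C)" for C using bd_subset[of C] by (simp add: Int_absorb2)
      show "(\<Prod>C\<in>{C \<in> L. e \<in> bd C}. 1 + g C * exp (7 * \<beta> * wt (bd C))) \<le> 1 + 7 * \<beta>" if "e \<in> E" for e
        using hierarchy_prod_le[OF H that b] unfolding g_def \<beta>_def .
    qed (use \<beta> in \<open>auto simp: g_def\<close>)
    moreover have "bd T \<inter> E = bd T" using bd_subset by auto
    ultimately have "exp (- ((1 - 4 * \<beta>) * wt (bd T))) * perc_sum l E (attached_weight bd g L (bd T))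
        \<le> exp (- ((1 - 4 * \<beta>) * wt (bd T))) * exp (7 * \<beta> * wt (bd T))"
      by (intro mult_left_mono) auto
    also have "\<dots> = exp (- ((1 - 11 * \<beta>) * wt (bd T)))"
      unfolding mult_exp_exp by (rule arg_cong[where f = exp]) (simp add: algebra_simps)
    also have "\<dots> \<le> exp (- ((1 - 11 * \<beta>) * \<rho>))"
      using chi[OF T(3)[OF TT]] \<beta> by (simp add: mult_left_mono)
    finally show "exp (- ((1 - 4 * \<beta>) * wt (bd T))) * perc_sum l E (attached_weight bd g L (bd T))
        \<le> exp (- ((1 - 11 * \<beta>) * \<rho>))" .
  qed
  also have "\<dots> \<le> 2 * exp (- ((1 - 11 * \<beta>) * \<rho>))"
    using T(2) by (simp add: mult_right_mono)
  finally show ?thesis unfolding \<beta>_def .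
qed

end

section \<open>Percolation on a countable graph\<close>

lemma edgesE:
  assumes "e \<in> edges V l"
  obtains u v where "e = {u, v}" "u \<in> V" "v \<in> V" "0 < l e"
  using assms unfolding edges_def by blast

lemma countable_edges:
  assumes "countable V"
  shows "countable (edges V l)"
proof (rule countable_subset)
  show "edges V l \<subseteq> (\<lambda>(u, v). {u, v}) ` (V \<times> V)" unfolding edges_def by auto
  show "countable ((\<lambda>(u, v). {u, v}) ` (V \<times> V))" using assms by (intro countable_image countable_SIGMA)
qed

lemma edge_boundary_eq_cut_edges: "edge_boundary V l S = cut_edges (edges V l) S"
  unfolding edge_boundary_def cut_edges_def by blast

lemma product_prob_space_percolation:
  "product_prob_space (\<lambda>e. measure_pmf (bernoulli_pmf (1 - exp (- l e))))"
  by (intro product_prob_spaceI prob_space_measure_pmf)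

lemma prob_space_percolation: "prob_space (percolation V l)"
  unfolding percolation_def by (intro prob_space_PiM prob_space_measure_pmf)

lemma edge_state_measurable:
  assumes "e \<in> edges V l"
  shows "{\<omega> \<in> space (percolation V l). P (\<omega> e)} \<in> sets (percolation V l)"
  unfolding percolation_def using assms by (intro sets_Collect_single') auto

text \<open>Split into the disjoint cylinder events \<open>A Q\<close> that the open edges within
  \<open>E\<close> are exactly those of \<open>Q\<close>.\<close>

lemma finite_pattern_prob:
  assumes E: "finite E" "E \<subseteq> edges V l"
  shows "{\<omega> \<in> space (percolation V l). R {e\<in>E. \<omega> e}} \<in> sets (percolation V l)"
    and "measure (percolation V l) {\<omega> \<in> space (percolation V l). R {e\<in>E. \<omega> e}}
      = perc_sum l E (\<lambda>Q. of_bool (R Q))"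
proof -
  let ?M = "\<lambda>e. measure_pmf (bernoulli_pmf (1 - exp (- l e)))"
  interpret product_prob_space ?M "edges V l" by (rule product_prob_space_percolation)
  define A where "A Q = prod_emb (edges V l) ?M E (Pi\<^sub>E E (\<lambda>e. {e \<in> Q}))" for Q
  have A_iff: "\<omega> \<in> A Q \<longleftrightarrow> \<omega> \<in> space (percolation V l) \<and> {e\<in>E. \<omega> e} = Q \<inter> E" for \<omega> Q
    unfolding A_def percolation_def space_PiM prod_emb_iff
    using E(2) by (auto simp: PiE_iff extensional_def restrict_def)
  have Asets: "A Q \<in> sets (percolation V l)" for Q
    unfolding A_def percolation_def using E by (intro sets_PiM_I) auto
  have l: "0 \<le> l e" if "e \<in> E" for e using that E(2) by (auto elim!: edgesE intro: less_imp_le)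
  have meas: "measure (percolation V l) (A Q) = (\<Prod>e\<in>Q. 1 - exp (- l e)) * (\<Prod>e\<in>E - Q. exp (- l e))"
    if Q: "Q \<subseteq> E" for Q
  proof -
    have "measure (percolation V l) (A Q) = (\<Prod>e\<in>E. measure (?M e) {e \<in> Q})"
      unfolding A_def percolation_def using E by (intro measure_PiM_emb) auto
    also have "\<dots> = (\<Prod>e\<in>E. if e \<in> Q then 1 - exp (- l e) else exp (- l e))"
      using l by (intro prod.cong) (auto simp: measure_pmf_single pmf_bernoulli_True pmf_bernoulli_False)
    also have "\<dots> = (\<Prod>e\<in>Q. 1 - exp (- l e)) * (\<Prod>e\<in>E - Q. exp (- l e))"
      using E(1) Q by (subst prod.If_cases) (auto simp: Int_absorb1 Diff_eq intro!: arg_cong2[where f = "(*)"])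
    finally show ?thesis .
  qed
  have eq: "{\<omega> \<in> space (percolation V l). R {e\<in>E. \<omega> e}} = (\<Union>Q\<in>{Q\<in>Pow E. R Q}. A Q)"
    by (auto simp: A_iff Int_absorb2)
  show "{\<omega> \<in> space (percolation V l). R {e\<in>E. \<omega> e}} \<in> sets (percolation V l)"
    unfolding eq using E(1) Asets by (intro sets.finite_UN) auto
  interpret Perc: prob_space "percolation V l" by (rule prob_space_percolation)
  have "measure (percolation V l) (\<Union>Q\<in>{Q\<in>Pow E. R Q}. A Q) = (\<Sum>Q\<in>{Q\<in>Pow E. R Q}. measure (percolation V l) (A Q))"
  proof (rule Perc.finite_measure_finite_Union)
    show "disjoint_family_on A {Q\<in>Pow E. R Q}"
      unfolding disjoint_family_on_def
    proof (intro ballI impI)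
      fix Q Q' assume "Q \<in> {Q\<in>Pow E. R Q}" "Q' \<in> {Q\<in>Pow E. R Q}" "Q \<noteq> Q'"
      then have "Q \<inter> E \<noteq> Q' \<inter> E" by (simp add: Int_absorb2)
      then show "A Q \<inter> A Q' = {}" by (auto simp: A_iff)
    qed
  qed (use E(1) Asets in auto)
  also have "\<dots> = (\<Sum>Q\<in>{Q\<in>Pow E. R Q}. (\<Prod>e\<in>Q. 1 - exp (- l e)) * (\<Prod>e\<in>E - Q. exp (- l e)))"
    using meas by (intro sum.cong) auto
  also have "\<dots> = perc_sum l E (\<lambda>Q. of_bool (R Q))"
    unfolding perc_sum_def using E(1) by (intro sum.mono_neutral_cong_left) auto
  finally show "measure (percolation V l) {\<omega> \<in> space (percolation V l). R {e\<in>E. \<omega> e}}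
      = perc_sum l E (\<lambda>Q. of_bool (R Q))" unfolding eq .
qed

section \<open>Closed cuts and clusters\<close>

definition closed_cut :: "'a set \<Rightarrow> ('a set \<Rightarrow> real) \<Rightarrow> ('a set \<Rightarrow> bool) \<Rightarrow> 'a set \<Rightarrow> bool" where
  "closed_cut V l \<omega> S \<longleftrightarrow> (\<forall>e\<in>edge_boundary V l S. \<not> \<omega> e)"

lemma closed_cut_linked:
  assumes "closed_cut V l \<omega> S" "x \<in> S" "linked (open_edges V l \<omega>) x z"
  shows "z \<in> S"
proof -
  have "(x, z) \<in> {(u, v). {u, v} \<in> open_edges V l \<omega>}\<^sup>*" using assms(3) by (simp add: linked_def)
  then show ?thesis
  proof (induction rule: rtrancl_induct)
    case (step y z)
    then have "{y, z} \<in> edges V l" "\<omega> {y, z}" by (auto simp: open_edges_def)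
    then show ?case
      using assms(1) step.IH unfolding closed_cut_def edge_boundary_eq_cut_edges
      by (auto simp: doubleton_in_cut_edges_iff)
  qed (use assms in simp)
qed

lemma closed_cut_cluster: "closed_cut V l \<omega> {y\<in>V. linked (open_edges V l \<omega>) x y}"
  unfolding closed_cut_def
proof
  let ?S = "{y\<in>V. linked (open_edges V l \<omega>) x y}"
  fix e assume "e \<in> edge_boundary V l ?S"
  then obtain u v where e: "e = {u, v}" "e \<in> edges V l" "u \<in> ?S" "v \<notin> ?S"
    unfolding edge_boundary_def by blast
  have "v \<in> V" using e(1,2) by (auto elim!: edgesE simp: doubleton_eq_iff)
  show "\<not> \<omega> e"
  proof
    assume "\<omega> e"
    then have "linked (open_edges V l \<omega>) x v"
      using e(1-3) unfolding linked_def by (auto simp: open_edges_def intro: rtrancl_into_rtrancl)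
    then show False using e(4) \<open>v \<in> V\<close> by simp
  qed
qed

lemma linked_refl: "linked F x x"
  by (simp add: linked_def)

text \<open>The cluster of \<open>x\<close> is itself a closed cut, and no open path leaves a closed
  cut.\<close>

lemma not_linked_iff:
  assumes "x \<in> V" "y \<in> V"
  shows "\<not> linked (open_edges V l \<omega>) x y \<longleftrightarrow> (\<exists>S. x \<in> S \<and> S \<subseteq> V - {y} \<and> closed_cut V l \<omega> S)"
proof
  assume "\<not> linked (open_edges V l \<omega>) x y"
  then show "\<exists>S. x \<in> S \<and> S \<subseteq> V - {y} \<and> closed_cut V l \<omega> S"
    using closed_cut_cluster[of V l \<omega> x] linked_refl assms
    by (intro exI[of _ "{y\<in>V. linked (open_edges V l \<omega>) x y}"]) auto
next
  assume "\<exists>S. x \<in> S \<and> S \<subseteq> V - {y} \<and> closed_cut V l \<omega> S"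
  then show "\<not> linked (open_edges V l \<omega>) x y" using closed_cut_linked by fastforce
qed

lemma finite_cluster_iff:
  assumes "x \<in> V"
  shows "finite {y\<in>V. linked (open_edges V l \<omega>) x y}
    \<longleftrightarrow> (\<exists>S. x \<in> S \<and> S \<subseteq> V \<and> finite S \<and> closed_cut V l \<omega> S)"
proof
  assume "finite {y\<in>V. linked (open_edges V l \<omega>) x y}"
  then show "\<exists>S. x \<in> S \<and> S \<subseteq> V \<and> finite S \<and> closed_cut V l \<omega> S"
    using closed_cut_cluster[of V l \<omega> x] linked_refl assms
    by (intro exI[of _ "{y\<in>V. linked (open_edges V l \<omega>) x y}"]) auto
next
  assume "\<exists>S. x \<in> S \<and> S \<subseteq> V \<and> finite S \<and> closed_cut V l \<omega> S"
  then obtain S where S: "x \<in> S" "finite S" "closed_cut V l \<omega> S" by blast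
  have "{y\<in>V. linked (open_edges V l \<omega>) x y} \<subseteq> S" using closed_cut_linked[OF S(3,1)] by blast
  then show "finite {y\<in>V. linked (open_edges V l \<omega>) x y}" using S(2) by (rule finite_subset)
qed

lemma closed_cut_measurable:
  assumes "countable V"
  shows "{\<omega> \<in> space (percolation V l). closed_cut V l \<omega> S} \<in> sets (percolation V l)"
proof -
  have sub: "edge_boundary V l S \<subseteq> edges V l" unfolding edge_boundary_def by blast
  have "countable (edge_boundary V l S)" using countable_edges[OF assms] sub by (rule countable_subset[rotated])
  moreover have "{\<omega> \<in> space (percolation V l). \<not> \<omega> e} \<in> sets (percolation V l)"
    if "e \<in> edge_boundary V l S" for e
    using edge_state_measurable[where P = Not] that sub by blast
  ultimately show ?thesis
    unfolding closed_cut_def by (intro sets.sets_Collect_countable_All')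
qed

definition cut_event :: "'a set \<Rightarrow> ('a set \<Rightarrow> real) \<Rightarrow> 'a \<Rightarrow> 'a set \<Rightarrow> ('a set \<Rightarrow> bool) set" where
  "cut_event V l x U = {\<omega> \<in> space (percolation V l). \<exists>S. x \<in> S \<and> S \<subseteq> U \<and> closed_cut V l \<omega> S}"

lemma cut_event_measurable:
  assumes "countable V" "finite U"
  shows "cut_event V l x U \<in> sets (percolation V l)"
proof -
  have "cut_event V l x U = (\<Union>S\<in>{S\<in>Pow U. x \<in> S}. {\<omega> \<in> space (percolation V l). closed_cut V l \<omega> S})"
    unfolding cut_event_def by auto
  also have "\<dots> \<in> sets (percolation V l)"
    using assms by (intro sets.finite_UN closed_cut_measurable) auto
  finally show ?thesis .
qed

text \<open>Transfer to a finite network with sinks \<open>W - U\<close>, so that the admissible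
  cuts are the sets \<open>S \<subseteq> U\<close> containing \<open>x\<close>. Restricting to the
  finite edge set \<open>E\<close> can only enlarge the event, since fewer edges are required to be
  closed.\<close>

lemma cut_event_prob_le:
  fixes h :: "nat \<Rightarrow> real"
  assumes V: "countable V" and U: "finite U" "x \<in> U" "U \<subseteq> V"
    and E: "finite E" "E \<subseteq> edges V l" and m: "card (U \<union> \<Union>E) < 2 * m + 2"
    and h: "\<And>k. 0 \<le> h k" "(\<Sum>k | 2 ^ k \<le> m. h k) \<le> 1 / 625"
    and iso: "\<And>C. C \<subseteq> U \<Longrightarrow> x \<notin> C \<Longrightarrow> C \<noteq> {} \<Longrightarrow> card C \<le> m
        \<Longrightarrow> 1 \<le> h (floor_log (card C)) * sum l (cut_edges E C)"
    and \<rho>: "\<And>S. x \<in> S \<Longrightarrow> S \<subseteq> U \<Longrightarrow> \<rho> \<le> sum l (cut_edges E S)"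
  shows "measure (percolation V l) (cut_event V l x U)
    \<le> 2 * exp (- ((1 - 11 * (\<Sum>k | 2 ^ k \<le> m. h k)) * \<rho>))"
proof -
  define W where "W = U \<union> \<Union>E"
  have finE2: "finite e" if "e \<in> E" for e using subsetD[OF E(2) that] by (auto elim!: edgesE)
  have fK: "finite {k. 2 ^ k \<le> m}"
  proof (rule finite_subset)
    show "{k. 2 ^ k \<le> m} \<subseteq> {..m}" using order_trans[OF less_imp_le[OF less_exp]] by auto
  qed simp
  \<comment> \<open>The dyadic scales not yet passed by a block of size \<open>n\<close>. At
    \<open>n = 1\<close> these are all scales up to \<open>m\<close>.\<close>
  define \<tau> where "\<tau> n = (\<Sum>k | 2 ^ k \<le> m \<and> n < 2 ^ Suc k. h k)" for n :: nat
  interpret cut_network W "W - U" x E l m "\<lambda>n. h (floor_log n)" \<tau>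
  proof
    show "finite W" using U(1) E(1) finE2 by (auto simp: W_def)
    show "finite E" by fact
    show "\<exists>u v. e = {u, v} \<and> u \<in> W \<and> v \<in> W" if "e \<in> E" for e
    proof -
      from that E(2) have "e \<in> edges V l" by auto
      then obtain u v where "e = {u, v}" by (rule edgesE)
      moreover from this have "u \<in> W" "v \<in> W" using that unfolding W_def by auto
      ultimately show ?thesis by blast
    qed
    show "0 \<le> l e" if "e \<in> E" for e using subsetD[OF E(2) that] by (auto elim!: edgesE)
    show "x \<in> W - (W - U)" using U by (auto simp: W_def)
    show "0 \<le> h (floor_log n)" for n by (rule h)
    show "0 \<le> \<tau> n" for n unfolding \<tau>_def using h by (intro sum_nonneg) auto
    show "\<tau> n' \<le> \<tau> n" if "n \<le> n'" for n n'
      unfolding \<tau>_def using h that by (intro sum_mono2) (auto intro: finite_subset[OF _ fK])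
    show "\<tau> n' + h (floor_log n) \<le> \<tau> n" if n: "1 \<le> n" "n \<le> m" "2 * n \<le> n'" for n n'
    proof -
      let ?A = "\<lambda>n :: nat. {k. 2 ^ k \<le> m \<and> n < 2 ^ Suc k}"
      have fin: "finite (?A n)" for n by (rule finite_subset[OF _ fK]) auto
      have lo: "2 ^ floor_log n \<le> n" and hi: "n < 2 * 2 ^ floor_log n"
        using n floor_log_exp2_le[of n] floor_log_exp2_gt[of n] by auto
      \<comment> \<open>Since \<open>2 * n \<le> n'\<close>, the scale of \<open>n\<close> has been
        passed at size \<open>n'\<close>.\<close>
      have notin: "floor_log n \<notin> ?A n'" using lo n by auto
      have "\<tau> n' + h (floor_log n) = sum h (insert (floor_log n) (?A n'))"
        
        unfolding \<tau>_def by (subst sum.insert[OF fin notin]) simp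
      also have "\<dots> \<le> \<tau> n"
        unfolding \<tau>_def using fin h lo hi n by (intro sum_mono2) auto
      finally show ?thesis .
    qed
    show "1 \<le> h (floor_log (card C)) * sum l (cut_edges E C)"
      if "C \<subseteq> W - (W - U)" "x \<notin> C" "C \<noteq> {}" "card C \<le> m" for C
      using that by (intro iso) auto
    show "card W < 2 * m + 2" using m by (simp add: W_def)
  qed
  have adm: "admissible S \<longleftrightarrow> x \<in> S \<and> S \<subseteq> U" for S
  proof -
    have "W - (W - U) = U" by (auto simp: W_def)
    then show ?thesis unfolding admissible_def by simp
  qed
  have \<tau>1: "\<tau> 1 = (\<Sum>k | 2 ^ k \<le> m. h k)"
  proof -
    have "(1::nat) < 2 ^ Suc k" for k by (rule one_less_power) auto
    then show ?thesis unfolding \<tau>_def by simp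
  qed
  let ?R = "\<lambda>Q. \<exists>S. admissible S \<and> bd S \<inter> Q = {}"
  interpret Perc: prob_space "percolation V l" by (rule prob_space_percolation)
  have "measure (percolation V l) (cut_event V l x U)
      \<le> measure (percolation V l) {\<omega> \<in> space (percolation V l). ?R {e\<in>E. \<omega> e}}"
  proof (rule Perc.finite_measure_mono)
    show "cut_event V l x U \<subseteq> {\<omega> \<in> space (percolation V l). ?R {e\<in>E. \<omega> e}}"
    proof
      fix \<omega> assume "\<omega> \<in> cut_event V l x U"
      then obtain S where S: "\<omega> \<in> space (percolation V l)" "x \<in> S" "S \<subseteq> U" "closed_cut V l \<omega> S"
        unfolding cut_event_def by auto
      have "bd S \<subseteq> edge_boundary V l S"
        unfolding edge_boundary_eq_cut_edges using E(2) by (auto simp: cut_edges_def)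
      then have "bd S \<inter> {e\<in>E. \<omega> e} = {}" using S(4) unfolding closed_cut_def by auto
      then show "\<omega> \<in> {\<omega> \<in> space (percolation V l). ?R {e\<in>E. \<omega> e}}" using S(1-3) adm by auto
    qed
    show "{\<omega> \<in> space (percolation V l). ?R {e\<in>E. \<omega> e}} \<in> sets (percolation V l)"
      by (rule finite_pattern_prob(1)[OF E])
  qed
  also have "\<dots> = perc_sum l E (\<lambda>Q. of_bool (?R Q))" by (rule finite_pattern_prob(2)[OF E])
  also have "\<dots> \<le> 2 * exp (- ((1 - 11 * \<tau> 1) * \<rho>))"
  proof (rule closed_cut_prob_le)
    show "\<tau> 1 \<le> 1 / 625" unfolding \<tau>1 by (rule h(2))
    show "\<And>S. admissible S \<Longrightarrow> \<rho> \<le> wt (bd S)" using \<rho> adm by auto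
  qed
  finally show ?thesis unfolding \<tau>1 .
qed

section \<open>Real-valued weights and the inverse profile\<close>

lemma total_weight_finite:
  assumes "finite F" "\<And>f. f \<in> F \<Longrightarrow> 0 \<le> l f"
  shows "total_weight l F = ennreal (sum l F)"
  using assms by (simp add: total_weight_def sum_ennreal)

lemma total_weight_approx:
  assumes "a < total_weight l F" "\<And>f. f \<in> F \<Longrightarrow> 0 \<le> l f"
  obtains F' where "finite F'" "F' \<subseteq> F" "a < ennreal (sum l F')"
proof -
  have "total_weight l F = (SUP F'\<in>{F'. finite F' \<and> F' \<subseteq> F}. \<Sum>f\<in>F'. ennreal (l f))"
    unfolding total_weight_def by (rule nonneg_infsum_complete) simp
  then obtain F' where F': "finite F'" "F' \<subseteq> F" "a < (\<Sum>f\<in>F'. ennreal (l f))"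
    using assms(1) by (auto simp: less_SUP_iff)
  moreover have "(\<Sum>f\<in>F'. ennreal (l f)) = ennreal (sum l F')"
    using F'(2) assms(2) by (intro sum_ennreal) auto
  ultimately show thesis using that by simp
qed

lemma enn2real_less:
  assumes "t < ennreal c"
  shows "enn2real t < c"
proof -
  have "t < top" using assms by (rule less_trans) simp
  then have "ennreal (enn2real t) < ennreal c" using assms by simp
  then show ?thesis by (simp add: ennreal_less_iff)
qed

text \<open>The value \<open>h = 0\<close> is excluded because the right-hand side is finite while
  \<open>1 / 0\<close> is infinite.\<close>

lemma inverse_ennreal_leD:
  assumes "1 / ennreal h \<le> ennreal w" "0 \<le> h"
  shows "1 \<le> h * w" "0 < h"
proof -
  have h: "h \<noteq> 0"
  proof
    assume "h = 0"
    then have "(top::ennreal) \<le> ennreal w" using assms(1) by simp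
    then show False by (simp add: top_unique)
  qed
  then show hp: "0 < h" using assms(2) by simp
  have "1 / ennreal h = ennreal (1 / h)" using divide_ennreal[of 1 h] hp by simp
  then have "ennreal (1 / h) \<le> ennreal w" using assms(1) by simp
  then have "1 / h \<le> w" using hp by (subst (asm) ennreal_le_iff2) auto
  then show "1 \<le> h * w" using hp by (simp add: field_simps)
qed

lemma inverse_ennreal_mono:
  assumes "h \<le> h'"
  shows "1 / ennreal h' \<le> 1 / ennreal h"
proof (cases "0 < h")
  case True
  then show ?thesis using assms divide_ennreal[of 1 h] divide_ennreal[of 1 h'] by (simp add: ennreal_leI frac_le)
next
  case False
  then show ?thesis by (simp add: ennreal_neg)
qed

definition profile_inv :: "'a set \<Rightarrow> ('a set \<Rightarrow> real) \<Rightarrow> nat \<Rightarrow> real" where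
  "profile_inv V l k = enn2real (1 / iso_profile V l (2 ^ k))"

lemma profile_inv_nonneg: "0 \<le> profile_inv V l k"
  by (simp add: profile_inv_def)

text \<open>Finiteness of the series makes each term finite, so that \<open>enn2real\<close> loses
  no information.\<close>

lemma profile_inv_eq:
  assumes "Psi_inv V l < top" "2 ^ k \<in> profile_domain V"
  shows "1 / iso_profile V l (2 ^ k) = ennreal (profile_inv V l k)"
proof -
  have "(\<Sum>k\<in>{k}. 1 / iso_profile V l (2 ^ k)) \<le> Psi_inv V l"
    unfolding Psi_inv_def using assms(2)
    by (subst nonneg_infsum_complete) (auto intro!: SUP_upper2[of "{k}"])
  then have "1 / iso_profile V l (2 ^ k) < top" using assms(1) by auto
  then show ?thesis by (simp add: profile_inv_def)
qed

lemma sum_profile_inv_le: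
  assumes fin: "Psi_inv V l < top" and K: "finite K" "\<And>k. k \<in> K \<Longrightarrow> 2 ^ k \<in> profile_domain V"
  shows "(\<Sum>k\<in>K. profile_inv V l k) \<le> enn2real (Psi_inv V l)"
proof -
  have "ennreal (\<Sum>k\<in>K. profile_inv V l k) = (\<Sum>k\<in>K. ennreal (profile_inv V l k))"
    by (rule sum_ennreal[symmetric]) (rule profile_inv_nonneg)
  also have "\<dots> = (\<Sum>k\<in>K. 1 / iso_profile V l (2 ^ k))"
    using K(2) profile_inv_eq[OF fin] by (intro sum.cong) auto
  also have "\<dots> \<le> Psi_inv V l"
    unfolding Psi_inv_def using K
    by (subst nonneg_infsum_complete) (auto intro!: SUP_upper)
  also have "\<dots> = ennreal (enn2real (Psi_inv V l))" using fin by simp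
  finally show ?thesis by (simp add: ennreal_le_iff)
qed

lemma floor_log_card_bounds:
  assumes "finite S" "S \<noteq> {}"
  shows "2 ^ floor_log (card S) \<le> card S" "card S \<le> 2 * 2 ^ floor_log (card S)"
  using assms floor_log_exp2_le[of "card S"] floor_log_exp2_gt[of "card S"]
  by (auto simp: card_gt_0_iff)

text \<open>\<open>S\<close> is a competitor in the profile at the largest power of 2 not exceeding
  \<open>card S\<close>.\<close>

lemma boundary_ge_inverse_profile:
  assumes fin: "Psi_inv V l < top" and S: "S \<subseteq> V" "finite S" "S \<noteq> {}" "finite V \<Longrightarrow> card S \<le> card V div 2"
  shows "2 ^ floor_log (card S) \<in> profile_domain V"
    and "1 / ennreal (profile_inv V l (floor_log (card S))) \<le> total_weight l (edge_boundary V l S)"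
proof -
  note b = floor_log_card_bounds[OF S(2,3)]
  show dom: "2 ^ floor_log (card S) \<in> profile_domain V"
    using b(1) S(4) by (auto simp: profile_domain_def)
  have "real (card S) \<le> real (card V) / 2" if "finite V" using S(4)[OF that] by linarith
  then have "iso_profile V l (2 ^ floor_log (card S)) \<le> total_weight l (edge_boundary V l S)"
    unfolding iso_profile_def using S b by (intro Inf_lower) blast
  moreover have "1 / ennreal (profile_inv V l (floor_log (card S))) = iso_profile V l (2 ^ floor_log (card S))"
    by (simp add: profile_inv_eq[OF fin dom, symmetric])
  ultimately show "1 / ennreal (profile_inv V l (floor_log (card S))) \<le> total_weight l (edge_boundary V l S)"
    by simp
qed

text \<open>A single term of the series is at most its sum. This is the source of the bound of
  \<chi> by \<Psi> from below.\<close>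

lemma boundary_ge_inverse_Psi_inv:
  assumes fin: "Psi_inv V l < top" and S: "S \<subseteq> V" "finite S" "S \<noteq> {}" "finite V \<Longrightarrow> card S \<le> card V div 2"
  shows "1 / ennreal (enn2real (Psi_inv V l)) \<le> total_weight l (edge_boundary V l S)"
proof -
  have "profile_inv V l (floor_log (card S)) \<le> enn2real (Psi_inv V l)"
    using sum_profile_inv_le[OF fin, of "{floor_log (card S)}"] boundary_ge_inverse_profile(1)[OF fin S] by simp
  then show ?thesis
    using boundary_ge_inverse_profile(2)[OF fin S] inverse_ennreal_mono order_trans by blast
qed

lemma eps_eq:
  assumes "Psi_inv V l < top"
  shows "eps V l = 25 * sqrt (enn2real (Psi_inv V l))"
proof (cases "Psi_inv V l = 0")
  case True
  then show ?thesis by (simp add: eps_def Psi_def)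
next
  case False
  define \<beta> where "\<beta> = enn2real (Psi_inv V l)"
  have \<beta>: "Psi_inv V l = ennreal \<beta>" "0 < \<beta>"
    using assms False by (auto simp: \<beta>_def enn2real_positive_iff zero_less_iff_neq_zero)
  then have "Psi V l = ennreal (1 / \<beta>)" unfolding Psi_def using divide_ennreal[of 1 \<beta>] by simp
  then show ?thesis using \<beta> by (simp add: eps_def real_sqrt_divide)
qed

text \<open>For \<open>\<beta> \<le> 1 / 625\<close> one has
  \<open>25 * sqrt \<beta> \<ge> 625 * \<beta>\<close>, so the exponents differ by at least
  \<open>614 * \<beta> * \<rho>\<close>. This is at least 1, and \<open>exp 1 \<ge> 2\<close>
  absorbs the prefactor.\<close>

lemma exponent_slack:
  fixes \<beta> \<rho> :: real
  assumes "0 < \<beta>" "\<beta> \<le> 1 / 625" "1 \<le> \<beta> * \<rho>"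
  shows "2 * exp (- ((1 - 11 * \<beta>) * \<rho>)) \<le> exp (- ((1 - 25 * sqrt \<beta>) * \<rho>))"
proof -
  have \<rho>: "0 < \<rho>" using assms by (smt (verit) mult_nonneg_nonpos)
  have "sqrt \<beta> \<le> sqrt ((1 / 25)\<^sup>2)" using assms by (intro real_sqrt_le_mono) (simp add: power2_eq_square)
  then have "sqrt \<beta> \<le> 1 / 25" by simp
  then have "sqrt \<beta> * sqrt \<beta> \<le> 1 / 25 * sqrt \<beta>" using assms by (intro mult_right_mono) auto
  then have "25 * \<beta> \<le> sqrt \<beta>" using assms by simp
  then have "614 * \<beta> * \<rho> \<le> (25 * sqrt \<beta> - 11 * \<beta>) * \<rho>" using \<rho> by (intro mult_right_mono) auto
  then have "1 \<le> (25 * sqrt \<beta> - 11 * \<beta>) * \<rho>" using assms by linarith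
  then have "exp 1 \<le> exp ((25 * sqrt \<beta> - 11 * \<beta>) * \<rho>)" by simp
  moreover have "(2::real) \<le> exp 1" using exp_ge_add_one_self[of "1::real"] by simp
  ultimately have "2 \<le> exp ((25 * sqrt \<beta> - 11 * \<beta>) * \<rho>)" by (rule order_trans[rotated])
  then have "2 * exp (- ((1 - 11 * \<beta>) * \<rho>)) \<le> exp ((25 * sqrt \<beta> - 11 * \<beta>) * \<rho>) * exp (- ((1 - 11 * \<beta>) * \<rho>))"
    by (intro mult_right_mono) auto
  also have "\<dots> = exp (- ((1 - 25 * sqrt \<beta>) * \<rho>))"
    unfolding mult_exp_exp by (rule arg_cong[where f = exp]) (simp add: algebra_simps)
  finally show ?thesis .
qed

section \<open>The finite case\<close>

lemma cut_edges_complement: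
  assumes "S \<subseteq> V" "\<And>e. e \<in> E \<Longrightarrow> \<exists>u v. e = {u, v} \<and> u \<in> V \<and> v \<in> V"
  shows "cut_edges E (V - S) = cut_edges E S"
proof (intro set_eqI)
  fix e show "e \<in> cut_edges E (V - S) \<longleftrightarrow> e \<in> cut_edges E S"
  proof (cases "e \<in> E")
    case True
    then obtain u v where "e = {u, v}" "u \<in> V" "v \<in> V" using assms(2) by blast
    then show ?thesis by (auto simp: doubleton_in_cut_edges_iff)
  qed (auto simp: cut_edges_def)
qed

lemma exp_neg_ennreal_mult:
  assumes "0 \<le> c" "0 \<le> \<rho>"
  shows "exp_neg (ennreal c * ennreal \<rho>) = exp (- (c * \<rho>))"
  using assms by (simp add: exp_neg_def ennreal_mult[symmetric])

lemma exp_neg_nonneg: "0 \<le> exp_neg t"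
  by (simp add: exp_neg_def)

lemma finite_connection_prob:
  assumes V: "finite V" and Psi: "Psi_inv V l < ennreal (1 / 625)" and x: "x \<in> V" and y: "y \<in> V"
  shows "1 - exp_neg (ennreal (1 - eps V l) * chi_pair V l x y)
    \<le> measure (percolation V l) (connection_event V l x y)"
proof (cases "x = y")
  case True
  interpret Perc: prob_space "percolation V l" by (rule prob_space_percolation)
  \<comment> \<open>No set contains \<open>x\<close> and avoids \<open>y = x\<close>, so
    \<open>chi_pair\<close> is an infimum over the empty set; here the event is certain.\<close>
  have "connection_event V l x y = space (percolation V l)"
    using True by (auto simp: connection_event_def linked_refl)
  then show ?thesis using exp_neg_nonneg by (simp add: Perc.prob_space)
next
  case False
  interpret Perc: prob_space "percolation V l" by (rule prob_space_percolation)
  define \<beta> where "\<beta> = enn2real (Psi_inv V l)"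
  have top: "Psi_inv V l < top" using Psi by (rule less_trans) simp
  have \<beta>: "0 \<le> \<beta>" "\<beta> < 1 / 625"
    using enn2real_less[OF Psi] unfolding \<beta>_def by simp_all
  define m where "m = card V div 2"
  let ?E = "edges V l"
  have edge: "\<exists>u v. e = {u, v} \<and> u \<in> V \<and> v \<in> V" if "e \<in> ?E" for e using that by (auto elim!: edgesE)
  have finE: "finite ?E"
    by (rule finite_subset[of _ "Pow V"]) (use V in \<open>auto elim!: edgesE\<close>)
  have tw: "total_weight l (edge_boundary V l S) = ennreal (sum l (cut_edges ?E S))" for S
    unfolding edge_boundary_eq_cut_edges
    by (rule total_weight_finite) (auto simp: cut_edges_def intro: finite_subset[OF _ finE] elim!: edgesE)
  define \<rho> where "\<rho> = enn2real (chi_pair V l x y)"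
  have chi_le: "chi_pair V l x y \<le> ennreal (sum l (cut_edges ?E S))" if "x \<in> S" "S \<subseteq> V - {y}" for S
    unfolding chi_pair_def tw[symmetric] using that by (intro Inf_lower) blast
  have "chi_pair V l x y < top" using chi_le[of "{x}"] x False by (auto intro: le_less_trans)
  then have chi: "chi_pair V l x y = ennreal \<rho>" "0 \<le> \<rho>" by (auto simp: \<rho>_def)
  \<comment> \<open>One of \<open>S\<close> and \<open>V - S\<close> has at most half of the
    vertices, and both have the same boundary.\<close>
  have small: "1 / ennreal \<beta> \<le> ennreal (sum l (cut_edges ?E S))" if "x \<in> S" "S \<subseteq> V - {y}" for S
  proof -
    have S: "S \<subseteq> V" "finite S" "S \<noteq> {}" "V - S \<noteq> {}" using that V y by (auto intro: finite_subset)
    have "card (V - S) = card V - card S" using S by (simp add: card_Diff_subset)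
    then consider "card S \<le> card V div 2" | "card (V - S) \<le> card V div 2" by linarith
    then show ?thesis
    proof cases
      case 1
      then show ?thesis unfolding \<beta>_def tw[symmetric] using S by (intro boundary_ge_inverse_Psi_inv[OF top])
    next
      case 2
      have "1 / ennreal \<beta> \<le> total_weight l (edge_boundary V l (V - S))"
        unfolding \<beta>_def using S 2 V by (intro boundary_ge_inverse_Psi_inv[OF top]) auto
      moreover have "cut_edges ?E (V - S) = cut_edges ?E S" using S(1) edge by (rule cut_edges_complement)
      ultimately show ?thesis unfolding tw by simp
    qed
  qed
  have "1 / ennreal \<beta> \<le> chi_pair V l x y"
    unfolding chi_pair_def tw using small by (intro Inf_greatest) auto
  then have \<beta>\<rho>: "1 \<le> \<beta> * \<rho>" "0 < \<beta>" unfolding chi(1) using \<beta>(1) inverse_ennreal_leD by blast+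
  have sumh: "(\<Sum>k | 2 ^ k \<le> m. profile_inv V l k) \<le> \<beta>"
  proof -
    have "finite {k. 2 ^ k \<le> m}"
      by (rule finite_subset[of _ "{..m}"]) (auto intro: order_trans[OF less_imp_le[OF less_exp]])
    then show ?thesis
      unfolding \<beta>_def using V by (intro sum_profile_inv_le[OF top]) (auto simp: profile_domain_def m_def)
  qed
  have "measure (percolation V l) (cut_event V l x (V - {y}))
      \<le> 2 * exp (- ((1 - 11 * (\<Sum>k | 2 ^ k \<le> m. profile_inv V l k)) * \<rho>))"
  proof (rule cut_event_prob_le)
    show "countable V" using V by (rule countable_finite)
    have "V - {y} \<union> \<Union> ?E \<subseteq> V" by (auto elim!: edgesE)
    then have "card (V - {y} \<union> \<Union> ?E) \<le> card V" using V by (rule card_mono[rotated])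
    then show "card (V - {y} \<union> \<Union> ?E) < 2 * m + 2" unfolding m_def by linarith
    show "(\<Sum>k | 2 ^ k \<le> m. profile_inv V l k) \<le> 1 / 625" using sumh \<beta> by linarith
    fix C assume C: "C \<subseteq> V - {y}" "C \<noteq> {}" "card C \<le> m"
    have "1 / ennreal (profile_inv V l (floor_log (card C))) \<le> ennreal (sum l (cut_edges ?E C))"
      unfolding tw[symmetric] using C V
      by (intro boundary_ge_inverse_profile(2)[OF top]) (auto simp: m_def intro: finite_subset)
    then show "1 \<le> profile_inv V l (floor_log (card C)) * sum l (cut_edges ?E C)"
      by (rule inverse_ennreal_leD(1)) (rule profile_inv_nonneg)
  next
    fix S assume S: "x \<in> S" "S \<subseteq> V - {y}"
    have nn: "0 \<le> sum l (cut_edges ?E S)" by (intro sum_nonneg) (auto simp: cut_edges_def elim!: edgesE)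
    show "\<rho> \<le> sum l (cut_edges ?E S)"
      using chi_le[OF S] nn unfolding chi(1) by (simp add: ennreal_le_iff)
  qed (use V x False finE profile_inv_nonneg in auto)
  also have "\<dots> \<le> 2 * exp (- ((1 - 11 * \<beta>) * \<rho>))"
    using sumh chi(2) by (auto intro!: mult_right_mono)
  also have "\<dots> \<le> exp (- ((1 - 25 * sqrt \<beta>) * \<rho>))"
    using \<beta>\<rho> \<beta> by (intro exponent_slack) auto
  also have "\<dots> = exp_neg (ennreal (1 - eps V l) * chi_pair V l x y)"
  proof -
    have "sqrt \<beta> \<le> sqrt ((1 / 25)\<^sup>2)" using \<beta> by (intro real_sqrt_le_mono) (simp add: power2_eq_square)
    then have "0 \<le> 1 - 25 * sqrt \<beta>" by simp
    then show ?thesis unfolding eps_eq[OF top] chi(1) \<beta>_def[symmetric] using chi(2) by (simp add: exp_neg_ennreal_mult)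
  qed
  finally have le: "measure (percolation V l) (cut_event V l x (V - {y}))
      \<le> exp_neg (ennreal (1 - eps V l) * chi_pair V l x y)" .
  have "connection_event V l x y = space (percolation V l) - cut_event V l x (V - {y})"
    unfolding connection_event_def cut_event_def using not_linked_iff[OF x y] by blast
  then have "measure (percolation V l) (connection_event V l x y)
      = 1 - measure (percolation V l) (cut_event V l x (V - {y}))"
    using V by (simp add: Perc.prob_compl cut_event_measurable countable_finite)
  then show ?thesis using le by simp
qed

section \<open>The infinite case\<close>

lemma finite_cut_event_prob_le:
  assumes V: "countable V" "infinite V" and Psi: "Psi_inv V l < top"
    and U: "finite U" "x \<in> U" "U \<subseteq> V"
    and \<delta>: "0 < \<delta>" "enn2real (Psi_inv V l) + \<delta> \<le> 1 / 625"
    and a: "0 \<le> a" "ennreal a < chi_infinity V l x"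
  shows "measure (percolation V l) (cut_event V l x U)
    \<le> 2 * exp (- ((1 - 11 * (enn2real (Psi_inv V l) + \<delta>)) * a))"
proof -
  \<comment> \<open>The added geometric series has total at most \<delta>. It makes
    \<open>1 / h k\<close> strictly smaller than the inverse of the profile term, even where that
    term is zero, which leaves room for truncating infinite boundaries.\<close>
  define h where "h k = profile_inv V l k + \<delta> * (1 / 2) ^ Suc k" for k
  have h_pos: "0 < h k" for k using profile_inv_nonneg[of V l k] \<delta> by (simp add: h_def add_nonneg_pos)
  define r where "r C = (if x \<in> C then a else 1 / h (floor_log (card C)))" for C
  have nonneg: "0 \<le> l e" if "e \<in> edge_boundary V l C" for e C
    using that unfolding edge_boundary_eq_cut_edges by (auto simp: cut_edges_def elim!: edgesE)
  have r_less: "ennreal (r C) < total_weight l (edge_boundary V l C)" if C: "C \<subseteq> U" "C \<noteq> {}" for C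
  proof -
    have C': "C \<subseteq> V" "finite C" using C U by (auto intro: finite_subset)
    show ?thesis
    proof (cases "x \<in> C")
      case True
      then have "chi_infinity V l x \<le> total_weight l (edge_boundary V l C)"
        unfolding chi_infinity_def using C' by (intro Inf_lower) blast
      then show ?thesis using a True by (simp add: r_def)
    next
      case False
      define p where "p = profile_inv V l (floor_log (card C))"
      have p: "0 \<le> p" "p < h (floor_log (card C))" using \<delta> profile_inv_nonneg by (auto simp: p_def h_def)
      have "ennreal (1 / h (floor_log (card C))) < 1 / ennreal p"
      proof (cases "p = 0")
        case False
        then have "1 / ennreal p = ennreal (1 / p)" using p divide_ennreal[of 1 p] by simp
        moreover have "1 / h (floor_log (card C)) < 1 / p" using p False by (intro divide_strict_left_mono) auto
        ultimately show ?thesis using p by (simp add: ennreal_less_iff)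
      qed simp
      also have "\<dots> \<le> total_weight l (edge_boundary V l C)"
        unfolding p_def using C C' V by (intro boundary_ge_inverse_profile(2)[OF Psi]) auto
      finally show ?thesis using False by (simp add: r_def)
    qed
  qed
  have ex: "\<exists>F. finite F \<and> F \<subseteq> edge_boundary V l C \<and> r C \<le> sum l F" if C: "C \<subseteq> U" "C \<noteq> {}" for C
  proof -
    obtain F where F: "finite F" "F \<subseteq> edge_boundary V l C" "ennreal (r C) < ennreal (sum l F)"
      by (rule total_weight_approx[OF r_less[OF C]], erule nonneg, blast)
    have "r C \<le> sum l F"
    proof (rule ccontr)
      assume "\<not> r C \<le> sum l F"
      then have "ennreal (sum l F) \<le> ennreal (r C)" by (intro ennreal_leI) simp
      then show False using F(3) by simp
    qed
    then show ?thesis using F by blast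
  qed
  \<comment> \<open>Finitely many edges of the boundary of \<open>C\<close> that already carry the
    weight required by \<open>r C\<close>. There are finitely many sets
    \<open>C \<subseteq> U\<close>, so the union of these choices is a finite edge set serving all
    of them.\<close>
  define F where "F C = (SOME F. finite F \<and> F \<subseteq> edge_boundary V l C \<and> r C \<le> sum l F)" for C
  have F: "finite (F C) \<and> F C \<subseteq> edge_boundary V l C \<and> r C \<le> sum l (F C)" if C: "C \<subseteq> U" "C \<noteq> {}" for C
    unfolding F_def using ex[OF C] by (rule someI_ex)
  define E where "E = (\<Union>C\<in>Pow U - {{}}. F C)"
  have finE: "finite E" unfolding E_def using U(1) F by (intro finite_UN_I) auto
  have sub_bd: "edge_boundary V l C \<subseteq> edges V l" for C unfolding edge_boundary_def by blast
  have subE: "E \<subseteq> edges V l"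
  proof
    fix e assume "e \<in> E"
    then obtain C where "C \<subseteq> U" "C \<noteq> {}" "e \<in> F C" unfolding E_def by auto
    then show "e \<in> edges V l" using F[of C] sub_bd[of C] by auto
  qed
  have r_le: "r C \<le> sum l (cut_edges E C)" if C: "C \<subseteq> U" "C \<noteq> {}" for C
  proof -
    have "F C \<subseteq> E" unfolding E_def using C by blast
    moreover have "F C \<subseteq> edge_boundary V l C" using F[OF C] by blast
    ultimately have "F C \<subseteq> cut_edges E C"
      unfolding edge_boundary_eq_cut_edges by (auto simp: cut_edges_def)
    then have "sum l (F C) \<le> sum l (cut_edges E C)"
    proof (rule sum_mono2[rotated])
      show "finite (cut_edges E C)" by (rule finite_subset[OF _ finE]) (auto simp: cut_edges_def)
      fix e assume "e \<in> cut_edges E C - F C"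
      then have "e \<in> edges V l" using subE by (auto simp: cut_edges_def)
      then show "0 \<le> l e" by (auto elim!: edgesE)
    qed
    then show ?thesis using F[OF C] by linarith
  qed
  \<comment> \<open>No size restriction arises in an infinite graph, so every vertex set of the
    finite network is allowed.\<close>
  define m where "m = card (U \<union> \<Union>E)"
  have finK: "finite {k. 2 ^ k \<le> m}"
    by (rule finite_subset[of _ "{..m}"]) (auto intro: order_trans[OF less_imp_le[OF less_exp]])
  have sum_h: "(\<Sum>k | 2 ^ k \<le> m. h k) \<le> enn2real (Psi_inv V l) + \<delta>"
  proof -
    have "(\<Sum>k | 2 ^ k \<le> m. h k) = (\<Sum>k | 2 ^ k \<le> m. profile_inv V l k) + \<delta> * (\<Sum>k | 2 ^ k \<le> m. (1 / 2) ^ Suc k)"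
      unfolding h_def sum.distrib sum_distrib_left ..
    moreover have "(\<Sum>k | 2 ^ k \<le> m. profile_inv V l k) \<le> enn2real (Psi_inv V l)"
      using V by (intro sum_profile_inv_le[OF Psi finK]) (auto simp: profile_domain_def)
    moreover have "(\<Sum>k | 2 ^ k \<le> m. (1 / 2 :: real) ^ Suc k) \<le> 1"
    proof -
      have "(\<Sum>k | 2 ^ k \<le> m. (1 / 2 :: real) ^ Suc k) \<le> (\<Sum>k. (1 / 2) ^ Suc k)"
        using power_half_series finK by (intro sum_le_suminf) (auto simp: sums_iff)
      then show ?thesis using power_half_series by (simp add: sums_iff)
    qed
    then have "\<delta> * (\<Sum>k | 2 ^ k \<le> m. (1 / 2) ^ Suc k) \<le> \<delta> * 1" using \<delta> by (intro mult_left_mono) auto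
    ultimately show ?thesis by linarith
  qed
  have "measure (percolation V l) (cut_event V l x U) \<le> 2 * exp (- ((1 - 11 * (\<Sum>k | 2 ^ k \<le> m. h k)) * a))"
  proof (rule cut_event_prob_le[OF V(1) U finE subE])
    show "card (U \<union> \<Union>E) < 2 * m + 2" by (simp add: m_def)
    show "0 \<le> h k" for k using h_pos[of k] by simp
    show "(\<Sum>k | 2 ^ k \<le> m. h k) \<le> 1 / 625" using sum_h \<delta> by linarith
    show "1 \<le> h (floor_log (card C)) * sum l (cut_edges E C)" if "C \<subseteq> U" "x \<notin> C" "C \<noteq> {}" for C
      using r_le[of C] that h_pos[of "floor_log (card C)"] by (simp add: r_def field_simps)
    show "a \<le> sum l (cut_edges E S)" if "x \<in> S" "S \<subseteq> U" for S
      using r_le[of S] that by (auto simp: r_def)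
  qed
  also have "\<dots> \<le> 2 * exp (- ((1 - 11 * (enn2real (Psi_inv V l) + \<delta>)) * a))"
    using sum_h a(1) by (auto intro!: mult_right_mono)
  finally show ?thesis .
qed

text \<open>The truncation parameters are removed by letting \<delta> tend to 0 and \<open>a\<close>
  tend to \<chi>. The factor 2 is absorbed by \<open>exponent_slack\<close>, or by letting
  \<open>a\<close> grow when \<chi> is infinite.\<close>

lemma finite_cut_event_prob_le_exp_neg:
  assumes V: "countable V" "infinite V" and Psi: "Psi_inv V l < ennreal (1 / 625)"
    and U: "finite U" "x \<in> U" "U \<subseteq> V"
  shows "measure (percolation V l) (cut_event V l x U) \<le> exp_neg (ennreal (1 - eps V l) * chi_infinity V l x)"
proof -
  define \<beta> where "\<beta> = enn2real (Psi_inv V l)"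
  have top: "Psi_inv V l < top" using Psi by (rule less_trans) simp
  have \<beta>: "0 \<le> \<beta>" "\<beta> < 1 / 625" using enn2real_less[OF Psi] unfolding \<beta>_def by simp_all
  define p where "p = measure (percolation V l) (cut_event V l x U)"
  define \<delta>0 where "\<delta>0 = 1 / 625 - \<beta>"
  have \<delta>0: "0 < \<delta>0" using \<beta> by (simp add: \<delta>0_def)
  have bound: "p \<le> 2 * exp (- ((1 - 11 * (\<beta> + \<delta>)) * a))"
    if "0 < \<delta>" "\<delta> \<le> \<delta>0" "0 \<le> a" "ennreal a < chi_infinity V l x" for \<delta> a
    unfolding p_def \<beta>_def using that
    by (intro finite_cut_event_prob_le[OF V top U]) (auto simp: \<delta>0_def \<beta>_def)
  have "sqrt \<beta> < sqrt ((1 / 25)\<^sup>2)" using \<beta> by (intro real_sqrt_less_mono) (simp add: power2_eq_square)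
  then have e: "0 < 1 - eps V l" unfolding eps_eq[OF top] \<beta>_def by simp
  show ?thesis
  proof (cases "chi_infinity V l x = top")
    case True
    define c where "c = 1 - 11 * (\<beta> + \<delta>0)"
    have c: "0 < c" by (simp add: c_def \<delta>0_def)
    have "p \<le> 0"
    proof (rule ccontr)
      assume "\<not> p \<le> 0"
      then have p: "0 < p" by simp
      \<comment> \<open>Chosen so that \<open>p * (1 + c * a) = p + 2\<close>, which contradicts
        \<open>p * exp (c * a) \<le> 2\<close>.\<close>
      define a where "a = 2 / (c * p)"
      have a: "0 \<le> a" using c p by (simp add: a_def)
      have "p \<le> 2 * exp (- (c * a))" using bound[of \<delta>0 a] \<delta>0 a True by (simp add: c_def)
      then have "p * exp (c * a) \<le> 2" by (simp add: exp_minus field_simps)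
      moreover have "p * (1 + c * a) \<le> p * exp (c * a)" using p by (intro mult_left_mono exp_ge_add_one_self) auto
      moreover have "p * (1 + c * a) = p + 2" using c p by (simp add: a_def field_simps)
      ultimately show False using p by linarith
    qed
    then show ?thesis using exp_neg_nonneg[of "ennreal (1 - eps V l) * chi_infinity V l x"] unfolding p_def by linarith
  next
    case False
    define \<rho> where "\<rho> = enn2real (chi_infinity V l x)"
    have chi: "chi_infinity V l x = ennreal \<rho>" using False by (simp add: \<rho>_def top.not_eq_extremum)
    have \<rho>0: "0 \<le> \<rho>" by (simp add: \<rho>_def)
    have "1 / ennreal \<beta> \<le> chi_infinity V l x"
      unfolding chi_infinity_def
    proof (rule Inf_greatest)
      fix t assume "t \<in> {total_weight l (edge_boundary V l S) | S. x \<in> S \<and> S \<subseteq> V \<and> finite S}"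
      then obtain S where S: "t = total_weight l (edge_boundary V l S)" "x \<in> S" "S \<subseteq> V" "finite S" by blast
      show "1 / ennreal \<beta> \<le> t"
        unfolding S(1) \<beta>_def using S V by (intro boundary_ge_inverse_Psi_inv[OF top]) auto
    qed
    then have \<beta>\<rho>: "1 \<le> \<beta> * \<rho>" "0 < \<beta>" unfolding chi using \<beta>(1) inverse_ennreal_leD by blast+
    then have \<rho>: "0 < \<rho>" using \<rho>0 by (cases "\<rho> = 0") auto
    have "p \<le> 2 * exp (- ((1 - 11 * (\<beta> + 0)) * (\<rho> - 0)))"
    proof (rule tendsto_lowerbound)
      show "((\<lambda>\<delta>. 2 * exp (- ((1 - 11 * (\<beta> + \<delta>)) * (\<rho> - \<delta>)))) \<longlongrightarrow> 2 * exp (- ((1 - 11 * (\<beta> + 0)) * (\<rho> - 0)))) (at_right 0)"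
        by (intro tendsto_intros)
      have "\<forall>\<^sub>F \<delta> in at_right 0. \<delta> \<in> {0<..<min \<delta>0 \<rho>}"
        using \<delta>0 \<rho> by (intro eventually_at_right_real) auto
      then show "\<forall>\<^sub>F \<delta> in at_right 0. p \<le> 2 * exp (- ((1 - 11 * (\<beta> + \<delta>)) * (\<rho> - \<delta>)))"
        by eventually_elim (intro bound, auto simp: chi ennreal_less_iff)
    qed simp
    also have "\<dots> \<le> exp (- ((1 - 25 * sqrt \<beta>) * \<rho>))"
      using \<beta>\<rho> \<beta> exponent_slack[of \<beta> \<rho>] by simp
    also have "\<dots> = exp_neg (ennreal (1 - eps V l) * chi_infinity V l x)"
      using e \<rho>0 unfolding eps_eq[OF top] chi \<beta>_def[symmetric] by (simp add: exp_neg_ennreal_mult)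
    finally show ?thesis unfolding p_def .
  qed
qed

text \<open>The cluster of \<open>x\<close> is finite exactly when a finite closed cut surrounds
  \<open>x\<close>, and such a cut fits into one of the sets \<open>U n\<close> exhausting
  \<open>V\<close>. The bound for \<open>U n\<close> is uniform in \<open>n\<close> and passes to
  the increasing union by continuity of the measure.\<close>

lemma infinite_connection_prob:
  assumes V: "countable V" "infinite V" and Psi: "Psi_inv V l < ennreal (1 / 625)" and x: "x \<in> V"
  shows "1 - exp_neg (ennreal (1 - eps V l) * chi_infinity V l x)
    \<le> measure (percolation V l) (infinity_event V l x)"
proof -
  interpret Perc: prob_space "percolation V l" by (rule prob_space_percolation)
  define U where "U n = insert x (from_nat_into V ` {..n})" for n
  have U: "finite (U n)" "x \<in> U n" "U n \<subseteq> V" for n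
    using x from_nat_into[OF infinite_imp_nonempty[OF V(2)]] by (auto simp: U_def)
  have monoU: "U n \<subseteq> U n'" if "n \<le> n'" for n n' using that by (auto simp: U_def)
  have cover: "\<exists>n. S \<subseteq> U n" if "finite S" "S \<subseteq> V" for S
    using that
  proof (induction S rule: finite_induct)
    case (insert s S)
    then obtain n where n: "S \<subseteq> U n" by auto
    obtain k where k: "s = from_nat_into V k"
      using insert.prems V(1) from_nat_into_surj[of V s] by auto
    have "insert s S \<subseteq> U (max n k)" using n monoU[of n "max n k"] k by (auto simp: U_def)
    then show ?case by blast
  qed simp
  let ?A = "\<lambda>n. cut_event V l x (U n)"
  have meas: "?A n \<in> sets (percolation V l)" for n by (rule cut_event_measurable[OF V(1) U(1)])
  have inc: "incseq ?A"
  proof (rule incseq_SucI)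
    fix n show "?A n \<subseteq> ?A (Suc n)"
      using monoU[of n "Suc n"] unfolding cut_event_def by fastforce
  qed
  have "infinity_event V l x = space (percolation V l) - (\<Union>n. ?A n)"
  proof (intro set_eqI iffI)
    fix \<omega> assume w: "\<omega> \<in> infinity_event V l x"
    then have "\<not> (\<exists>S. x \<in> S \<and> S \<subseteq> V \<and> finite S \<and> closed_cut V l \<omega> S)"
      unfolding infinity_event_def using finite_cluster_iff[OF x] by auto
    then have "\<omega> \<notin> ?A n" for n
      using U(3)[of n] finite_subset[OF _ U(1)[of n]] unfolding cut_event_def by auto
    then show "\<omega> \<in> space (percolation V l) - (\<Union>n. ?A n)" using w by (auto simp: infinity_event_def)
  next
    fix \<omega> assume w: "\<omega> \<in> space (percolation V l) - (\<Union>n. ?A n)"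
    have "\<not> (\<exists>S. x \<in> S \<and> S \<subseteq> V \<and> finite S \<and> closed_cut V l \<omega> S)"
    proof
      assume "\<exists>S. x \<in> S \<and> S \<subseteq> V \<and> finite S \<and> closed_cut V l \<omega> S"
      then obtain S where S: "x \<in> S" "S \<subseteq> V" "finite S" "closed_cut V l \<omega> S" by auto
      from cover[OF S(3,2)] obtain n where "S \<subseteq> U n" by auto
      then have "\<omega> \<in> ?A n" using S w by (auto simp: cut_event_def)
      then show False using w by auto
    qed
    then show "\<omega> \<in> infinity_event V l x"
      using w finite_cluster_iff[OF x] by (auto simp: infinity_event_def)
  qed
  then have "measure (percolation V l) (infinity_event V l x) = 1 - measure (percolation V l) (\<Union>n. ?A n)"
    using meas by (simp add: Perc.prob_compl)
  moreover have "measure (percolation V l) (\<Union>n. ?A n) \<le> exp_neg (ennreal (1 - eps V l) * chi_infinity V l x)"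
  proof (rule LIMSEQ_le_const2)
    show "(\<lambda>n. measure (percolation V l) (?A n)) \<longlonglongrightarrow> measure (percolation V l) (\<Union>n. ?A n)"
      using meas inc by (intro Perc.finite_Lim_measure_incseq) auto
    show "\<exists>N. \<forall>n\<ge>N. measure (percolation V l) (?A n) \<le> exp_neg (ennreal (1 - eps V l) * chi_infinity V l x)"
      using finite_cut_event_prob_le_exp_neg[OF V Psi U] by blast
  qed
  ultimately show ?thesis by simp
qed

theorem theorem1p1:
  fixes V :: "'a set" and l :: "'a set \<Rightarrow> real"
  assumes "weighted_graph V l"
    and "Psi_inv V l < ennreal (1 / 625)"
  shows "eps V l < 1 \<and>
    (finite V \<longrightarrow> (\<forall>x\<in>V. \<forall>y\<in>V.
       measure (percolation V l) (connection_event V l x y)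
         \<ge> 1 - exp_neg (ennreal (1 - eps V l) * chi_pair V l x y))) \<and>
    (infinite V \<longrightarrow> (\<forall>x\<in>V.
       measure (percolation V l) (infinity_event V l x)
         \<ge> 1 - exp_neg (ennreal (1 - eps V l) * chi_infinity V l x)))"
proof -
  have V: "countable V" using assms(1) by (simp add: weighted_graph_def)
  have top: "Psi_inv V l < top" using assms(2) by (rule less_trans) simp
  have "enn2real (Psi_inv V l) < (1 / 25)\<^sup>2"
    using enn2real_less[OF assms(2)] by (simp add: power2_eq_square)
  then have "sqrt (enn2real (Psi_inv V l)) < sqrt ((1 / 25)\<^sup>2)" by (rule real_sqrt_less_mono)
  then have "eps V l < 1" unfolding eps_eq[OF top] by simp
  then show ?thesis
    using finite_connection_prob[OF _ assms(2)] infinite_connection_prob[OF V _ assms(2)] by blast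
qed

end
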